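(* For every $n\ge 1$, in the blocked-braid group $\mathbf{BB}_n$ one has $(ST_nR)^4=S1_{A^n}R$, i.e. the fourth power of $ST_nR$ is the identity element, where $$T_n=(\sigma_1)(\sigma_2\sigma_1)\cdots(\sigma_{n-2}\sigma_{n-3}\cdots\sigma_1)(\sigma_{n-1}\sigma_{n-2}\cdots\sigma_2\sigma_1).$$
   Context: Composition of arrows is written by juxtaposition, $fg$ meaning first $g$, then $f$. Empty products are identities. A braided strict monoidal category is a category with a strictly associative and unitary tensor functor $\otimes$ with unit $I$, and a natural family of isomorphisms (twist) $\tau_{A,B}:A\otimes B\to B\otimes A$ such that $\tau_{A,B\otimes C}=(1_B\otimes\tau_{A,C})(\tau_{A,B}\otimes 1_C)$ and $\tau_{A\otimes B,C}=(\tau_{A,C}\otimes 1_B)(1_A\otimes\tau_{B,C})$. $A^n$ denotes the $n$-fold tensor power of $A$. A tangle algebra in such a category is an object $A$ with arrows $\eta:I\to A\otimes A$ and $\epsilon:A\otimes A\to I$ satisfying $(\epsilon\otimes 1_A)(1_A\otimes\eta)=1_A=(1_A\otimes\epsilon)(\eta\otimes 1_A)$, $\epsilon\tau_{A,A}=\epsilon$ and $\tau_{A,A}\eta=\eta$. $\mathbf{Tangle}_n$ is the free braided strict monoidal category generated by an object $A$ with a tangle algebra structure and two arrows $R:I\to A^n$ and $S:A^n\to I$ (subject to no further equations). For $1\le i<n$, $\sigma_i:A^n\to A^n$ is the arrow $1_{A^{i-1}}\otimes\tau_{A,A}\otimes 1_{A^{n-i-1}}$. A braid in $\mathbf{Tangle}_n$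 is an arrow $B:A^n\to A^n$ that is a composite of arrows each of which is a tensor of identities and arrows $\tau_{A,A}$ or $\tau_{A,A}^{-1}$. A blocked braid on $n$ strings is an arrow $I\to I$ of $\mathbf{Tangle}_n$ of the form $SBR$ with $B$ a braid; equality of blocked braids is equality of arrows in $\mathbf{Tangle}_n$. The blocked-braid group $\mathbf{BB}_n$ has as elements the blocked braids on $n$ strings, identity $S1_{A^n}R$, product $(SBR)(SB'R)=SBB'R$ and inverse $(SBR)^{-1}=SB^{-1}R$ (these operations are well defined). The power $(ST_nR)^4$ is taken in this group. *)

theory Defs
  imports "HOL-Algebra.Group"
begin

section \<open>Braided strict monoidal categories\<close>

text \<open>\<open>f \<cdot> g\<close> is first \<open>g\<close>, then \<open>f\<close>; \<open>\<boxdot>\<close> is the tensor product of objects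
  and \<open>\<boxtimes>\<close> that of arrows.\<close>

record ('o, 'a) bsm =
  Obj :: "'o set"
  Hom :: "'o \<Rightarrow> 'o \<Rightarrow> 'a set"
  Idt :: "'o \<Rightarrow> 'a"
  Comp :: "'a \<Rightarrow> 'a \<Rightarrow> 'a"  (infixl "\<cdot>\<index>" 70)
  Unit :: 'o
  OTens :: "'o \<Rightarrow> 'o \<Rightarrow> 'o"  (infixl "\<boxdot>\<index>" 75)
  Tens :: "'a \<Rightarrow> 'a \<Rightarrow> 'a"  (infixl "\<boxtimes>\<index>" 75)
  Twist :: "'o \<Rightarrow> 'o \<Rightarrow> 'a"

definition is_inverse :: "('o, 'a, 'z) bsm_scheme \<Rightarrow> 'o \<Rightarrow> 'o \<Rightarrow> 'a \<Rightarrow> 'a \<Rightarrow> bool" where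
  "is_inverse C a b f g \<longleftrightarrow>
     g \<in> Hom C b a \<and> g \<cdot>\<^bsub>C\<^esub> f = Idt C a \<and> f \<cdot>\<^bsub>C\<^esub> g = Idt C b"

definition inv_arrow :: "('o, 'a, 'z) bsm_scheme \<Rightarrow> 'o \<Rightarrow> 'o \<Rightarrow> 'a \<Rightarrow> 'a" where
  "inv_arrow C a b f = (THE g. is_inverse C a b f g)"

locale braided_strict_monoidal_category =
  fixes C :: "('o, 'a, 'z) bsm_scheme" (structure)
  assumes hom_obj: "f \<in> Hom C a b \<Longrightarrow> a \<in> Obj C \<and> b \<in> Obj C"
    and hom_disjoint: "\<lbrakk>f \<in> Hom C a b; f \<in> Hom C a' b'\<rbrakk> \<Longrightarrow> a = a' \<and> b = b'"
    and id_hom: "a \<in> Obj C \<Longrightarrow> Idt C a \<in> Hom C a a"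
    and comp_hom: "\<lbrakk>f \<in> Hom C b c; g \<in> Hom C a b\<rbrakk> \<Longrightarrow> f \<cdot> g \<in> Hom C a c"
    and id_comp: "f \<in> Hom C a b \<Longrightarrow> Idt C b \<cdot> f = f"
    and comp_id: "f \<in> Hom C a b \<Longrightarrow> f \<cdot> Idt C a = f"
    and comp_assoc: "\<lbrakk>f \<in> Hom C c d; g \<in> Hom C b c; h \<in> Hom C a b\<rbrakk>
          \<Longrightarrow> (f \<cdot> g) \<cdot> h = f \<cdot> (g \<cdot> h)"
    and unit_obj: "Unit C \<in> Obj C"
    and otens_obj: "\<lbrakk>a \<in> Obj C; b \<in> Obj C\<rbrakk> \<Longrightarrow> a \<boxdot> b \<in> Obj C"
    and otens_assoc: "\<lbrakk>a \<in> Obj C; b \<in> Obj C; c \<in> Obj C\<rbrakk>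
          \<Longrightarrow> (a \<boxdot> b) \<boxdot> c = a \<boxdot> (b \<boxdot> c)"
    and unit_otens: "a \<in> Obj C \<Longrightarrow> Unit C \<boxdot> a = a"
    and otens_unit: "a \<in> Obj C \<Longrightarrow> a \<boxdot> Unit C = a"
    and tens_hom: "\<lbrakk>f \<in> Hom C a b; g \<in> Hom C c d\<rbrakk> \<Longrightarrow> f \<boxtimes> g \<in> Hom C (a \<boxdot> c) (b \<boxdot> d)"
    and tens_id: "\<lbrakk>a \<in> Obj C; b \<in> Obj C\<rbrakk> \<Longrightarrow> Idt C a \<boxtimes> Idt C b = Idt C (a \<boxdot> b)"
    and interchange: "\<lbrakk>f \<in> Hom C b c; g \<in> Hom C a b; f' \<in> Hom C b' c'; g' \<in> Hom C a' b'\<rbrakk>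
          \<Longrightarrow> (f \<cdot> g) \<boxtimes> (f' \<cdot> g') = (f \<boxtimes> f') \<cdot> (g \<boxtimes> g')"
    and tens_assoc: "\<lbrakk>f \<in> Hom C a a'; g \<in> Hom C b b'; h \<in> Hom C c c'\<rbrakk>
          \<Longrightarrow> (f \<boxtimes> g) \<boxtimes> h = f \<boxtimes> (g \<boxtimes> h)"
    and unit_tens: "f \<in> Hom C a b \<Longrightarrow> Idt C (Unit C) \<boxtimes> f = f"
    and tens_unit: "f \<in> Hom C a b \<Longrightarrow> f \<boxtimes> Idt C (Unit C) = f"
    and twist_hom: "\<lbrakk>a \<in> Obj C; b \<in> Obj C\<rbrakk> \<Longrightarrow> Twist C a b \<in> Hom C (a \<boxdot> b) (b \<boxdot> a)"
    and twist_iso: "\<lbrakk>a \<in> Obj C; b \<in> Obj C\<rbrakk>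
          \<Longrightarrow> \<exists>g. is_inverse C (a \<boxdot> b) (b \<boxdot> a) (Twist C a b) g"
    and twist_natural: "\<lbrakk>f \<in> Hom C a b; g \<in> Hom C c d\<rbrakk>
          \<Longrightarrow> Twist C b d \<cdot> (f \<boxtimes> g) = (g \<boxtimes> f) \<cdot> Twist C a c"
    and twist_otens_right: "\<lbrakk>a \<in> Obj C; b \<in> Obj C; c \<in> Obj C\<rbrakk>
          \<Longrightarrow> Twist C a (b \<boxdot> c) = (Idt C b \<boxtimes> Twist C a c) \<cdot> (Twist C a b \<boxtimes> Idt C c)"
    and twist_otens_left: "\<lbrakk>a \<in> Obj C; b \<in> Obj C; c \<in> Obj C\<rbrakk>
          \<Longrightarrow> Twist C (a \<boxdot> b) c = (Twist C a c \<boxtimes> Idt C b) \<cdot> (Idt C a \<boxtimes> Twist C b c)"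

primrec opow :: "('o, 'a, 'z) bsm_scheme \<Rightarrow> 'o \<Rightarrow> nat \<Rightarrow> 'o" where
  "opow C a 0 = Unit C"
| "opow C a (Suc k) = a \<boxdot>\<^bsub>C\<^esub> opow C a k"

locale tangle_algebra = braided_strict_monoidal_category C
  for C :: "('o, 'a, 'z) bsm_scheme" (structure) +
  fixes A :: 'o and \<eta> \<epsilon> :: 'a
  assumes A_obj: "A \<in> Obj C"
    and eta_hom: "\<eta> \<in> Hom C (Unit C) (A \<boxdot> A)"
    and eps_hom: "\<epsilon> \<in> Hom C (A \<boxdot> A) (Unit C)"
    and zigzag_left: "(\<epsilon> \<boxtimes> Idt C A) \<cdot> (Idt C A \<boxtimes> \<eta>) = Idt C A"
    and zigzag_right: "(Idt C A \<boxtimes> \<epsilon>) \<cdot> (\<eta> \<boxtimes> Idt C A) = Idt C A"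
    and eps_twist: "\<epsilon> \<cdot> Twist C A A = \<epsilon>"
    and twist_eta: "Twist C A A \<cdot> \<eta> = \<eta>"

locale tangle_model = tangle_algebra C A \<eta> \<epsilon>
  for C :: "('o, 'a, 'z) bsm_scheme" (structure) and A \<eta> \<epsilon> +
  fixes n :: nat and R S :: 'a
  assumes R_hom: "R \<in> Hom C (Unit C) (opow C A n)"
    and S_hom: "S \<in> Hom C (opow C A n) (Unit C)"

locale strict_braided_functor =
  fixes C :: "('o, 'a, 'z) bsm_scheme" and D :: "('p, 'b, 'y) bsm_scheme"
    and F0 :: "'o \<Rightarrow> 'p" and F1 :: "'a \<Rightarrow> 'b"
  assumes F_obj: "a \<in> Obj C \<Longrightarrow> F0 a \<in> Obj D"
    and F_hom: "f \<in> Hom C a b \<Longrightarrow> F1 f \<in> Hom D (F0 a) (F0 b)"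
    and F_id: "a \<in> Obj C \<Longrightarrow> F1 (Idt C a) = Idt D (F0 a)"
    and F_comp: "\<lbrakk>f \<in> Hom C b c; g \<in> Hom C a b\<rbrakk> \<Longrightarrow> F1 (f \<cdot>\<^bsub>C\<^esub> g) = F1 f \<cdot>\<^bsub>D\<^esub> F1 g"
    and F_unit: "F0 (Unit C) = Unit D"
    and F_otens: "\<lbrakk>a \<in> Obj C; b \<in> Obj C\<rbrakk> \<Longrightarrow> F0 (a \<boxdot>\<^bsub>C\<^esub> b) = F0 a \<boxdot>\<^bsub>D\<^esub> F0 b"
    and F_tens: "\<lbrakk>f \<in> Hom C a b; g \<in> Hom C c d\<rbrakk> \<Longrightarrow> F1 (f \<boxtimes>\<^bsub>C\<^esub> g) = F1 f \<boxtimes>\<^bsub>D\<^esub> F1 g"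
    and F_twist: "\<lbrakk>a \<in> Obj C; b \<in> Obj C\<rbrakk> \<Longrightarrow> F1 (Twist C a b) = Twist D (F0 a) (F0 b)"


section \<open>The free category on a tangle algebra and arrows R, S\<close>

text \<open>The objects of the free category are the tensor powers of the generator, so the object
  \<open>A^k\<close> is represented by the number \<open>k\<close>. Arrows are classes of well-typed terms modulo the
  congruence generated by the axioms above.\<close>

datatype tm =
    TId nat
  | TComp tm tm
  | TTens tm tm
  | TTwist nat nat
  | TUntwist nat nat
  | TEta
  | TEps
  | TR
  | TS

inductive typed :: "nat \<Rightarrow> tm \<Rightarrow> nat \<Rightarrow> nat \<Rightarrow> bool" for n where
  ty_id: "typed n (TId a) a a"
| ty_comp: "\<lbrakk>typed n f b c; typed n g a b\<rbrakk> \<Longrightarrow> typed n (TComp f g) a c"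
| ty_tens: "\<lbrakk>typed n f a b; typed n g c d\<rbrakk> \<Longrightarrow> typed n (TTens f g) (a + c) (b + d)"
| ty_twist: "typed n (TTwist a b) (a + b) (b + a)"
| ty_untwist: "typed n (TUntwist a b) (b + a) (a + b)"
| ty_eta: "typed n TEta 0 2"
| ty_eps: "typed n TEps 2 0"
| ty_R: "typed n TR 0 n"
| ty_S: "typed n TS n 0"

inductive teq :: "nat \<Rightarrow> tm \<Rightarrow> tm \<Rightarrow> bool" for n where
  teq_refl: "typed n f a b \<Longrightarrow> teq n f f"
| teq_sym: "teq n f g \<Longrightarrow> teq n g f"
| teq_trans: "\<lbrakk>teq n f g; teq n g h\<rbrakk> \<Longrightarrow> teq n f h"
| teq_comp: "\<lbrakk>teq n f f'; teq n g g'; typed n f b c; typed n g a b\<rbrakk>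
    \<Longrightarrow> teq n (TComp f g) (TComp f' g')"
| teq_tens: "\<lbrakk>teq n f f'; teq n g g'\<rbrakk> \<Longrightarrow> teq n (TTens f g) (TTens f' g')"
| teq_id_comp: "typed n f a b \<Longrightarrow> teq n (TComp (TId b) f) f"
| teq_comp_id: "typed n f a b \<Longrightarrow> teq n (TComp f (TId a)) f"
| teq_comp_assoc: "\<lbrakk>typed n f c d; typed n g b c; typed n h a b\<rbrakk>
    \<Longrightarrow> teq n (TComp (TComp f g) h) (TComp f (TComp g h))"
| teq_tens_id: "teq n (TTens (TId a) (TId b)) (TId (a + b))"
| teq_interchange: "\<lbrakk>typed n f b c; typed n g a b; typed n f' b' c'; typed n g' a' b'\<rbrakk>
    \<Longrightarrow> teq n (TTens (TComp f g) (TComp f' g')) (TComp (TTens f f') (TTens g g'))"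
| teq_tens_assoc: "\<lbrakk>typed n f a a'; typed n g b b'; typed n h c c'\<rbrakk>
    \<Longrightarrow> teq n (TTens (TTens f g) h) (TTens f (TTens g h))"
| teq_unit_tens: "typed n f a b \<Longrightarrow> teq n (TTens (TId 0) f) f"
| teq_tens_unit: "typed n f a b \<Longrightarrow> teq n (TTens f (TId 0)) f"
| teq_untwist_twist: "teq n (TComp (TUntwist a b) (TTwist a b)) (TId (a + b))"
| teq_twist_untwist: "teq n (TComp (TTwist a b) (TUntwist a b)) (TId (b + a))"
| teq_twist_natural: "\<lbrakk>typed n f a b; typed n g c d\<rbrakk>
    \<Longrightarrow> teq n (TComp (TTwist b d) (TTens f g)) (TComp (TTens g f) (TTwist a c))"
| teq_twist_right: "teq n (TTwist a (b + c))
    (TComp (TTens (TId b) (TTwist a c)) (TTens (TTwist a b) (TId c)))"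
| teq_twist_left: "teq n (TTwist (a + b) c)
    (TComp (TTens (TTwist a c) (TId b)) (TTens (TId a) (TTwist b c)))"
| teq_zigzag_left: "teq n (TComp (TTens TEps (TId 1)) (TTens (TId 1) TEta)) (TId 1)"
| teq_zigzag_right: "teq n (TComp (TTens (TId 1) TEps) (TTens TEta (TId 1))) (TId 1)"
| teq_eps_twist: "teq n (TComp TEps (TTwist 1 1)) TEps"
| teq_twist_eta: "teq n (TComp (TTwist 1 1) TEta) TEta"

definition tcls :: "nat \<Rightarrow> tm \<Rightarrow> tm set" where
  "tcls n f = {g. teq n f g}"

text \<open>On classes, the set-valued right-hand sides of composition and tensor are the classes
  of \<^term>\<open>TComp f g\<close> and \<^term>\<open>TTens f g\<close> for any representatives; see \<open>comp_tcls\<close>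
  and \<open>tens_tcls\<close> below.\<close>

definition Tangle :: "nat \<Rightarrow> (nat, tm set) bsm" where
  "Tangle n = \<lparr>
     Obj = UNIV,
     Hom = (\<lambda>a b. {tcls n f | f. typed n f a b}),
     Idt = (\<lambda>a. tcls n (TId a)),
     Comp = (\<lambda>X Y. {h. \<exists>f\<in>X. \<exists>g\<in>Y. teq n (TComp f g) h}),
     Unit = 0,
     OTens = (+),
     Tens = (\<lambda>X Y. {h. \<exists>f\<in>X. \<exists>g\<in>Y. teq n (TTens f g) h}),
     Twist = (\<lambda>a b. tcls n (TTwist a b))\<rparr>"

abbreviation (input) gen_A :: nat where "gen_A \<equiv> 1"
definition gen_eta :: "nat \<Rightarrow> tm set" where "gen_eta n = tcls n TEta"
definition gen_eps :: "nat \<Rightarrow> tm set" where "gen_eps n = tcls n TEps"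
definition gen_R :: "nat \<Rightarrow> tm set" where "gen_R n = tcls n TR"
definition gen_S :: "nat \<Rightarrow> tm set" where "gen_S n = tcls n TS"


lemma typed_unique: "\<lbrakk>typed n f a b; typed n f a' b'\<rbrakk> \<Longrightarrow> a = a' \<and> b = b'"
proof (induction arbitrary: a' b' rule: typed.induct)
  case (ty_comp f b c g a)
  from ty_comp.prems show ?case
    by (cases rule: typed.cases) (use ty_comp.IH in blast)+
next
  case (ty_tens f a b g c d)
  from ty_tens.prems show ?case
    by (cases rule: typed.cases) (use ty_tens.IH in blast)+
qed (auto elim: typed.cases)

lemma teq_typed: "teq n f g \<Longrightarrow> \<exists>a b. typed n f a b \<and> typed n g a b"
proof (induction rule: teq.induct)
  case (teq_trans f g h)
  then show ?case by (metis typed_unique)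
next
  case (teq_comp f f' g g' b c a)
  then show ?case by (metis typed_unique ty_comp)
next
  case (teq_tens f f' g g')
  then show ?case by (metis ty_tens)
next
  case (teq_id_comp f a b)
  then show ?case using ty_comp ty_id by blast
next
  case (teq_comp_id f a b)
  then show ?case using ty_comp ty_id by blast
next
  case (teq_comp_assoc f c d g b h a)
  then show ?case using ty_comp by blast
next
  case (teq_tens_id a b)
  then show ?case using ty_tens ty_id by blast
next
  case (teq_interchange f b c g a f' b' c' g' a')
  then have "typed n (TTens (TComp f g) (TComp f' g')) (a + a') (c + c')"
    "typed n (TComp (TTens f f') (TTens g g')) (a + a') (c + c')"
    by (auto intro: ty_tens ty_comp)
  then show ?case by blast
next
  case (teq_tens_assoc f a a' g b b' h c c')
  then have "typed n (TTens (TTens f g) h) (a + b + c) (a' + b' + c')"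
    "typed n (TTens f (TTens g h)) (a + (b + c)) (a' + (b' + c'))"
    using ty_tens by blast+
  then show ?case by (auto simp: add.assoc)
next
  case (teq_unit_tens f a b)
  then show ?case using ty_tens[OF ty_id[of n 0], of f a b] by auto
next
  case (teq_tens_unit f a b)
  then show ?case using ty_tens[OF _ ty_id[of n 0], of f a b] by auto
next
  case (teq_untwist_twist a b)
  then show ?case by (meson ty_comp ty_id ty_twist ty_untwist)
next
  case (teq_twist_untwist a b)
  then show ?case by (meson ty_comp ty_id ty_twist ty_untwist)
next
  case (teq_twist_natural f a b g c d)
  then show ?case by (meson ty_comp ty_tens ty_twist)
next
  case (teq_twist_right a b c)
  have "typed n (TTens (TId b) (TTwist a c)) (b + (a + c)) (b + (c + a))"
    "typed n (TTens (TTwist a b) (TId c)) (a + b + c) (b + a + c)"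
    by (intro ty_tens ty_id ty_twist)+
  then have "typed n (TComp (TTens (TId b) (TTwist a c)) (TTens (TTwist a b) (TId c)))
      (a + b + c) (b + (c + a))"
    by (metis ty_comp add.assoc)
  moreover have "typed n (TTwist a (b + c)) (a + b + c) (b + (c + a))"
    by (metis ty_twist add.assoc)
  ultimately show ?case by blast
next
  case (teq_twist_left a b c)
  have "typed n (TTens (TTwist a c) (TId b)) (a + c + b) (c + a + b)"
    "typed n (TTens (TId a) (TTwist b c)) (a + (b + c)) (a + (c + b))"
    by (intro ty_tens ty_id ty_twist)+
  then have "typed n (TComp (TTens (TTwist a c) (TId b)) (TTens (TId a) (TTwist b c)))
      (a + b + c) (c + (a + b))"
    by (metis ty_comp add.assoc)
  moreover have "typed n (TTwist (a + b) c) (a + b + c) (c + (a + b))"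
    by (metis ty_twist)
  ultimately show ?case by blast
next
  case teq_zigzag_left
  have "typed n (TTens TEps (TId 1)) (2 + 1) (0 + 1)" "typed n (TTens (TId 1) TEta) (1 + 0) (1 + 2)"
    by (intro ty_tens ty_id ty_eta ty_eps)+
  then have "typed n (TComp (TTens TEps (TId 1)) (TTens (TId 1) TEta)) 1 1"
    by (metis ty_comp add.commute add_0)
  then show ?case using ty_id by blast
next
  case teq_zigzag_right
  have "typed n (TTens (TId 1) TEps) (1 + 2) (1 + 0)" "typed n (TTens TEta (TId 1)) (0 + 1) (2 + 1)"
    by (intro ty_tens ty_id ty_eta ty_eps)+
  then have "typed n (TComp (TTens (TId 1) TEps) (TTens TEta (TId 1))) 1 1"
    by (metis ty_comp add.commute add_0)
  then show ?case using ty_id by blast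
next
  case teq_eps_twist
  have "typed n (TTwist 1 1) 2 2"
    using ty_twist[of n 1 1] by (simp add: numeral_2_eq_2)
  then show ?case using ty_comp ty_eps by blast
next
  case teq_twist_eta
  have "typed n (TTwist 1 1) 2 2"
    using ty_twist[of n 1 1] by (simp add: numeral_2_eq_2)
  then show ?case using ty_comp ty_eta by blast
qed blast+

lemma teq_typed_left: "\<lbrakk>teq n f g; typed n f a b\<rbrakk> \<Longrightarrow> typed n g a b"
  by (metis teq_typed typed_unique)

lemma teq_typed_right: "\<lbrakk>teq n f g; typed n g a b\<rbrakk> \<Longrightarrow> typed n f a b"
  by (metis teq_typed typed_unique)

lemma tcls_eqI: "teq n f g \<Longrightarrow> tcls n f = tcls n g"
  unfolding tcls_def using teq_sym teq_trans by blast

lemma tcls_eq_iff: "typed n f a b \<Longrightarrow> tcls n f = tcls n g \<longleftrightarrow> teq n f g"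
  using tcls_eqI teq_refl teq_sym unfolding tcls_def by blast

lemma Tangle_simps [simp]:
  "Obj (Tangle n) = UNIV"
  "Idt (Tangle n) a = tcls n (TId a)"
  "Unit (Tangle n) = 0"
  "a \<boxdot>\<^bsub>Tangle n\<^esub> b = a + b"
  "Twist (Tangle n) a b = tcls n (TTwist a b)"
  by (simp_all add: Tangle_def)

lemma Tangle_HomI: "typed n f a b \<Longrightarrow> tcls n f \<in> Hom (Tangle n) a b"
  by (auto simp: Tangle_def)

lemma Tangle_HomE:
  assumes "X \<in> Hom (Tangle n) a b"
  obtains f where "typed n f a b" "X = tcls n f"
  using assms by (auto simp: Tangle_def)

lemma comp_tcls:
  assumes "typed n f b c" "typed n g a b"
  shows "tcls n f \<cdot>\<^bsub>Tangle n\<^esub> tcls n g = tcls n (TComp f g)"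
proof -
  have "teq n (TComp f g) h" if "teq n f f'" "teq n g g'" "teq n (TComp f' g') h" for f' g' h
    using that assms teq_comp teq_trans by blast
  then show ?thesis
    using teq_refl[OF assms(1)] teq_refl[OF assms(2)] by (auto simp: Tangle_def tcls_def)
qed

lemma tens_tcls:
  assumes "typed n f a b" "typed n g c d"
  shows "tcls n f \<boxtimes>\<^bsub>Tangle n\<^esub> tcls n g = tcls n (TTens f g)"
proof -
  have "teq n (TTens f g) h" if "teq n f f'" "teq n g g'" "teq n (TTens f' g') h" for f' g' h
    using that teq_tens teq_trans by blast
  then show ?thesis
    using teq_refl[OF assms(1)] teq_refl[OF assms(2)] by (auto simp: Tangle_def tcls_def)
qed

lemma opow_Tangle [simp]: "opow (Tangle n) gen_A k = k"
  by (induction k) auto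

lemmas opow_Tangle_Suc [simp] = opow_Tangle[unfolded One_nat_def]

lemma Tangle_twist_inverse:
  "is_inverse (Tangle n) (a + b) (b + a) (tcls n (TTwist a b)) (tcls n (TUntwist a b))"
  unfolding is_inverse_def
  by (simp add: Tangle_HomI comp_tcls[OF ty_untwist ty_twist] comp_tcls[OF ty_twist ty_untwist]
      ty_untwist tcls_eqI teq_untwist_twist teq_twist_untwist)

lemma typed_Twist_assoc:
  "typed n (TTens (TId b) (TTwist a c)) (b + a + c) (b + c + a)"
  "typed n (TTens (TTwist a c) (TId b)) (a + c + b) (c + a + b)"
  "typed n (TTens (TId a) (TTwist b c)) (a + b + c) (a + c + b)"
  using ty_tens[OF ty_id ty_twist] ty_tens[OF ty_twist ty_id] by (metis add.assoc)+

interpretation Tangle: braided_strict_monoidal_category "Tangle n"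
proof
  show "\<And>f a b. f \<in> Hom (Tangle n) a b \<Longrightarrow> a \<in> Obj (Tangle n) \<and> b \<in> Obj (Tangle n)"
    by simp
  show "\<And>f a b a' b'. f \<in> Hom (Tangle n) a b \<Longrightarrow> f \<in> Hom (Tangle n) a' b' \<Longrightarrow> a = a' \<and> b = b'"
    by (elim Tangle_HomE) (metis tcls_eq_iff teq_typed_left typed_unique)
  show "\<And>a. a \<in> Obj (Tangle n) \<Longrightarrow> Idt (Tangle n) a \<in> Hom (Tangle n) a a"
    by (simp add: Tangle_HomI ty_id)
  show "\<And>f b c g a. f \<in> Hom (Tangle n) b c \<Longrightarrow> g \<in> Hom (Tangle n) a b
      \<Longrightarrow> f \<cdot>\<^bsub>Tangle n\<^esub> g \<in> Hom (Tangle n) a c"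
    by (elim Tangle_HomE) (simp add: comp_tcls Tangle_HomI ty_comp)
  show "\<And>f a b. f \<in> Hom (Tangle n) a b \<Longrightarrow> Idt (Tangle n) b \<cdot>\<^bsub>Tangle n\<^esub> f = f"
    by (elim Tangle_HomE) (simp add: comp_tcls[OF ty_id] tcls_eqI teq_id_comp)
  show "\<And>f a b. f \<in> Hom (Tangle n) a b \<Longrightarrow> f \<cdot>\<^bsub>Tangle n\<^esub> Idt (Tangle n) a = f"
    by (elim Tangle_HomE) (simp add: comp_tcls[OF _ ty_id] tcls_eqI teq_comp_id)
  show "\<And>f c d g b h a. f \<in> Hom (Tangle n) c d \<Longrightarrow> g \<in> Hom (Tangle n) b c
      \<Longrightarrow> h \<in> Hom (Tangle n) a b
      \<Longrightarrow> f \<cdot>\<^bsub>Tangle n\<^esub> g \<cdot>\<^bsub>Tangle n\<^esub> h = f \<cdot>\<^bsub>Tangle n\<^esub> (g \<cdot>\<^bsub>Tangle n\<^esub> h)"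
    by (elim Tangle_HomE) (simp add: comp_tcls comp_tcls[OF ty_comp] comp_tcls[OF _ ty_comp]
        tcls_eqI teq_comp_assoc)
  show "\<And>f a b g c d. f \<in> Hom (Tangle n) a b \<Longrightarrow> g \<in> Hom (Tangle n) c d
      \<Longrightarrow> f \<boxtimes>\<^bsub>Tangle n\<^esub> g \<in> Hom (Tangle n) (a \<boxdot>\<^bsub>Tangle n\<^esub> c) (b \<boxdot>\<^bsub>Tangle n\<^esub> d)"
    by (elim Tangle_HomE) (simp add: tens_tcls Tangle_HomI ty_tens)
  show "\<And>a b. a \<in> Obj (Tangle n) \<Longrightarrow> b \<in> Obj (Tangle n) \<Longrightarrow>
      Idt (Tangle n) a \<boxtimes>\<^bsub>Tangle n\<^esub> Idt (Tangle n) b = Idt (Tangle n) (a \<boxdot>\<^bsub>Tangle n\<^esub> b)"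
    by (simp add: tens_tcls[OF ty_id ty_id] tcls_eqI teq_tens_id)
  show "\<And>f b c g a f' b' c' g' a'. f \<in> Hom (Tangle n) b c \<Longrightarrow> g \<in> Hom (Tangle n) a b
      \<Longrightarrow> f' \<in> Hom (Tangle n) b' c' \<Longrightarrow> g' \<in> Hom (Tangle n) a' b'
      \<Longrightarrow> (f \<cdot>\<^bsub>Tangle n\<^esub> g) \<boxtimes>\<^bsub>Tangle n\<^esub> (f' \<cdot>\<^bsub>Tangle n\<^esub> g')
        = f \<boxtimes>\<^bsub>Tangle n\<^esub> f' \<cdot>\<^bsub>Tangle n\<^esub> (g \<boxtimes>\<^bsub>Tangle n\<^esub> g')"
    by (elim Tangle_HomE)
      (simp add: comp_tcls tens_tcls ty_comp comp_tcls[OF ty_tens ty_tens] tens_tcls[OF ty_comp ty_comp]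
        tcls_eqI teq_interchange)
  show "\<And>f a a' g b b' h c c'. f \<in> Hom (Tangle n) a a' \<Longrightarrow> g \<in> Hom (Tangle n) b b'
      \<Longrightarrow> h \<in> Hom (Tangle n) c c'
      \<Longrightarrow> f \<boxtimes>\<^bsub>Tangle n\<^esub> g \<boxtimes>\<^bsub>Tangle n\<^esub> h = f \<boxtimes>\<^bsub>Tangle n\<^esub> (g \<boxtimes>\<^bsub>Tangle n\<^esub> h)"
    by (elim Tangle_HomE)
      (simp add: tens_tcls tens_tcls[OF ty_tens] tens_tcls[OF _ ty_tens] tcls_eqI teq_tens_assoc)
  show "\<And>f a b. f \<in> Hom (Tangle n) a b \<Longrightarrow> Idt (Tangle n) (Unit (Tangle n)) \<boxtimes>\<^bsub>Tangle n\<^esub> f = f"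
    by (elim Tangle_HomE) (simp add: tens_tcls[OF ty_id] tcls_eqI teq_unit_tens)
  show "\<And>f a b. f \<in> Hom (Tangle n) a b \<Longrightarrow> f \<boxtimes>\<^bsub>Tangle n\<^esub> Idt (Tangle n) (Unit (Tangle n)) = f"
    by (elim Tangle_HomE) (simp add: tens_tcls[OF _ ty_id] tcls_eqI teq_tens_unit)
  show "\<And>a b. a \<in> Obj (Tangle n) \<Longrightarrow> b \<in> Obj (Tangle n) \<Longrightarrow>
      Twist (Tangle n) a b \<in> Hom (Tangle n) (a \<boxdot>\<^bsub>Tangle n\<^esub> b) (b \<boxdot>\<^bsub>Tangle n\<^esub> a)"
    by (simp add: Tangle_HomI ty_twist)
  show "\<And>a b. a \<in> Obj (Tangle n) \<Longrightarrow> b \<in> Obj (Tangle n) \<Longrightarrow>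
      \<exists>g. is_inverse (Tangle n) (a \<boxdot>\<^bsub>Tangle n\<^esub> b) (b \<boxdot>\<^bsub>Tangle n\<^esub> a) (Twist (Tangle n) a b) g"
    using Tangle_twist_inverse by auto
  show "\<And>f a b g c d. f \<in> Hom (Tangle n) a b \<Longrightarrow> g \<in> Hom (Tangle n) c d
      \<Longrightarrow> Twist (Tangle n) b d \<cdot>\<^bsub>Tangle n\<^esub> (f \<boxtimes>\<^bsub>Tangle n\<^esub> g)
        = g \<boxtimes>\<^bsub>Tangle n\<^esub> f \<cdot>\<^bsub>Tangle n\<^esub> Twist (Tangle n) a c"
    by (elim Tangle_HomE)
      (simp add: tens_tcls comp_tcls[OF ty_twist ty_tens] comp_tcls[OF ty_tens ty_twist]
        tcls_eqI teq_twist_natural)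
  show "\<And>a b c. a \<in> Obj (Tangle n) \<Longrightarrow> b \<in> Obj (Tangle n) \<Longrightarrow> c \<in> Obj (Tangle n) \<Longrightarrow>
      Twist (Tangle n) a (b \<boxdot>\<^bsub>Tangle n\<^esub> c)
      = Idt (Tangle n) b \<boxtimes>\<^bsub>Tangle n\<^esub> Twist (Tangle n) a c \<cdot>\<^bsub>Tangle n\<^esub>
        (Twist (Tangle n) a b \<boxtimes>\<^bsub>Tangle n\<^esub> Idt (Tangle n) c)"
    by (simp add: tens_tcls[OF ty_id ty_twist] tens_tcls[OF ty_twist ty_id]
        comp_tcls[OF typed_Twist_assoc(1) typed_Twist_assoc(2)] tcls_eqI teq_twist_right)
  show "\<And>a b c. a \<in> Obj (Tangle n) \<Longrightarrow> b \<in> Obj (Tangle n) \<Longrightarrow> c \<in> Obj (Tangle n) \<Longrightarrow>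
      Twist (Tangle n) (a \<boxdot>\<^bsub>Tangle n\<^esub> b) c
      = Twist (Tangle n) a c \<boxtimes>\<^bsub>Tangle n\<^esub> Idt (Tangle n) b \<cdot>\<^bsub>Tangle n\<^esub>
        (Idt (Tangle n) a \<boxtimes>\<^bsub>Tangle n\<^esub> Twist (Tangle n) b c)"
    by (simp add: tens_tcls[OF ty_id ty_twist] tens_tcls[OF ty_twist ty_id]
        comp_tcls[OF typed_Twist_assoc(2) typed_Twist_assoc(3)] tcls_eqI teq_twist_left)
qed (auto simp: add.assoc)

lemma Tangle_gens:
  "gen_eta n \<in> Hom (Tangle n) 0 2" "gen_eps n \<in> Hom (Tangle n) 2 0"
  "gen_R n \<in> Hom (Tangle n) 0 n" "gen_S n \<in> Hom (Tangle n) n 0"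
  by (simp_all add: gen_eta_def gen_eps_def gen_R_def gen_S_def Tangle_HomI ty_eta ty_eps ty_R ty_S)

lemma Tangle_tangle_model:
  assumes R: "R \<in> Hom (Tangle n) 0 n" and S: "S \<in> Hom (Tangle n) n 0"
  shows "tangle_model (Tangle n) gen_A (gen_eta n) (gen_eps n) n R S"
proof
  have t: "typed n (TTwist 1 1) 2 2"
    using ty_twist[of n 1 1] by (simp add: numeral_2_eq_2)
  have z: "typed n (TTens TEps (TId 1)) 3 1" "typed n (TTens (TId 1) TEta) 1 3"
    "typed n (TTens (TId 1) TEps) 3 1" "typed n (TTens TEta (TId 1)) 1 3"
    using ty_tens[OF ty_eps ty_id[of n 1]] ty_tens[OF ty_id[of n 1] ty_eta]
      ty_tens[OF ty_id[of n 1] ty_eps] ty_tens[OF ty_eta ty_id[of n 1]] by (simp_all add: eval_nat_numeral)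
  show "gen_eta n \<in> Hom (Tangle n) (Unit (Tangle n)) (gen_A \<boxdot>\<^bsub>Tangle n\<^esub> gen_A)"
    "gen_eps n \<in> Hom (Tangle n) (gen_A \<boxdot>\<^bsub>Tangle n\<^esub> gen_A) (Unit (Tangle n))"
    using Tangle_gens[of n] by (simp_all add: numeral_2_eq_2)
  show "gen_eps n \<boxtimes>\<^bsub>Tangle n\<^esub> Idt (Tangle n) gen_A \<cdot>\<^bsub>Tangle n\<^esub>
      (Idt (Tangle n) gen_A \<boxtimes>\<^bsub>Tangle n\<^esub> gen_eta n) = Idt (Tangle n) gen_A"
    using teq_zigzag_left[of n]
    by (simp add: gen_eps_def gen_eta_def tens_tcls[OF ty_eps ty_id] tens_tcls[OF ty_id ty_eta]
        comp_tcls[OF z(1)[simplified] z(2)[simplified]] tcls_eqI)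
  show "Idt (Tangle n) gen_A \<boxtimes>\<^bsub>Tangle n\<^esub> gen_eps n \<cdot>\<^bsub>Tangle n\<^esub>
      (gen_eta n \<boxtimes>\<^bsub>Tangle n\<^esub> Idt (Tangle n) gen_A) = Idt (Tangle n) gen_A"
    using teq_zigzag_right[of n]
    by (simp add: gen_eps_def gen_eta_def tens_tcls[OF ty_id ty_eps] tens_tcls[OF ty_eta ty_id]
        comp_tcls[OF z(3)[simplified] z(4)[simplified]] tcls_eqI)
  show "gen_eps n \<cdot>\<^bsub>Tangle n\<^esub> Twist (Tangle n) gen_A gen_A = gen_eps n"
    using teq_eps_twist[of n] by (simp add: gen_eps_def comp_tcls[OF ty_eps t[simplified]] tcls_eqI)
  show "Twist (Tangle n) gen_A gen_A \<cdot>\<^bsub>Tangle n\<^esub> gen_eta n = gen_eta n"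
    using teq_twist_eta[of n] by (simp add: gen_eta_def comp_tcls[OF t[simplified] ty_eta] tcls_eqI)
  show "R \<in> Hom (Tangle n) (Unit (Tangle n)) (opow (Tangle n) gen_A n)"
    "S \<in> Hom (Tangle n) (opow (Tangle n) gen_A n) (Unit (Tangle n))"
    using R S by simp_all
qed simp


subsection \<open>The universal property\<close>

text \<open>\<open>Tangle n\<close> is itself a model (\<open>Tangle_tangle_model\<close>), and into every other model there is
  exactly one structure-preserving functor (\<open>F_functor\<close>, \<open>F_arr_gens\<close>, \<open>F_unique\<close>).\<close>

context braided_strict_monoidal_category
begin

lemma is_inverse_unique:
  assumes "f \<in> Hom C a b" "is_inverse C a b f g" "is_inverse C a b f h"
  shows "g = h"
  using assms comp_assoc[of g b a f b h] id_comp[of h b a] comp_id[of g b a]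
  unfolding is_inverse_def by (metis comp_assoc comp_id id_comp)

lemma inv_arrow_eqI: "\<lbrakk>f \<in> Hom C a b; is_inverse C a b f g\<rbrakk> \<Longrightarrow> inv_arrow C a b f = g"
  unfolding inv_arrow_def using is_inverse_unique by blast

lemma opow_obj: "a \<in> Obj C \<Longrightarrow> opow C a k \<in> Obj C"
  by (induction k) (auto simp: unit_obj otens_obj)

lemma opow_add: "a \<in> Obj C \<Longrightarrow> opow C a (j + k) = opow C a j \<boxdot> opow C a k"
  by (induction j) (auto simp: unit_otens opow_obj otens_assoc)

end

primrec interp :: "('o, 'a, 'z) bsm_scheme \<Rightarrow> 'o \<Rightarrow> 'a \<Rightarrow> 'a \<Rightarrow> 'a \<Rightarrow> 'a \<Rightarrow> tm \<Rightarrow> 'a" where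
  "interp C A \<eta> \<epsilon> R S (TId k) = Idt C (opow C A k)"
| "interp C A \<eta> \<epsilon> R S (TComp f g) = interp C A \<eta> \<epsilon> R S f \<cdot>\<^bsub>C\<^esub> interp C A \<eta> \<epsilon> R S g"
| "interp C A \<eta> \<epsilon> R S (TTens f g) = interp C A \<eta> \<epsilon> R S f \<boxtimes>\<^bsub>C\<^esub> interp C A \<eta> \<epsilon> R S g"
| "interp C A \<eta> \<epsilon> R S (TTwist j k) = Twist C (opow C A j) (opow C A k)"
| "interp C A \<eta> \<epsilon> R S (TUntwist j k) =
     inv_arrow C (opow C A j \<boxdot>\<^bsub>C\<^esub> opow C A k) (opow C A k \<boxdot>\<^bsub>C\<^esub> opow C A j)
       (Twist C (opow C A j) (opow C A k))"
| "interp C A \<eta> \<epsilon> R S TEta = \<eta>"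
| "interp C A \<eta> \<epsilon> R S TEps = \<epsilon>"
| "interp C A \<eta> \<epsilon> R S TR = R"
| "interp C A \<eta> \<epsilon> R S TS = S"

context tangle_model
begin

abbreviation "ev \<equiv> interp C A \<eta> \<epsilon> R S"
abbreviation "Apow \<equiv> opow C A"

lemma Apow_obj [simp]: "Apow k \<in> Obj C"
  by (simp add: A_obj opow_obj)

lemma Apow_add: "Apow (j + k) = Apow j \<boxdot> Apow k"
  by (simp add: A_obj opow_add)

lemma Apow_1 [simp]: "Apow (Suc 0) = A"
  by (simp add: A_obj otens_unit)

lemma Apow_2: "Apow 2 = A \<boxdot> A"
  by (simp add: numeral_2_eq_2 A_obj otens_unit)

lemma ev_untwist:
  "is_inverse C (Apow j \<boxdot> Apow k) (Apow k \<boxdot> Apow j) (Twist C (Apow j) (Apow k)) (ev (TUntwist j k))"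
  using twist_iso[of "Apow j" "Apow k"] inv_arrow_eqI twist_hom by fastforce

lemma ev_hom: "typed n f a b \<Longrightarrow> ev f \<in> Hom C (Apow a) (Apow b)"
proof (induction rule: typed.induct)
  case (ty_untwist a b)
  show ?case using ev_untwist[of a b] by (simp add: is_inverse_def Apow_add)
qed (auto simp: Apow_add Apow_2 id_hom comp_hom tens_hom twist_hom R_hom S_hom eta_hom eps_hom)

lemma ev_teq: "teq n f g \<Longrightarrow> ev f = ev g"
proof (induction rule: teq.induct)
  case (teq_id_comp f a b)
  then show ?case by (simp add: id_comp[OF ev_hom])
next
  case (teq_comp_id f a b)
  then show ?case by (simp add: comp_id[OF ev_hom])
next
  case (teq_comp_assoc f c d g b h a)
  then show ?case by (simp add: comp_assoc[OF ev_hom ev_hom ev_hom])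
next
  case (teq_tens_id a b)
  then show ?case by (simp add: tens_id Apow_add)
next
  case (teq_interchange f b c g a f' b' c' g' a')
  then show ?case by (simp add: interchange[OF ev_hom ev_hom ev_hom ev_hom])
next
  case (teq_tens_assoc f a a' g b b' h c c')
  then show ?case by (simp add: tens_assoc[OF ev_hom ev_hom ev_hom])
next
  case (teq_unit_tens f a b)
  then show ?case by (simp add: unit_tens[OF ev_hom])
next
  case (teq_tens_unit f a b)
  then show ?case by (simp add: tens_unit[OF ev_hom])
next
  case (teq_untwist_twist a b)
  then show ?case using ev_untwist[of a b] by (simp add: is_inverse_def Apow_add)
next
  case (teq_twist_untwist a b)
  then show ?case using ev_untwist[of a b] by (simp add: is_inverse_def Apow_add)
next
  case (teq_twist_natural f a b g c d)
  then show ?case by (simp add: twist_natural[OF ev_hom ev_hom])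
next
  case (teq_twist_right a b c)
  then show ?case by (simp add: Apow_add twist_otens_right)
next
  case (teq_twist_left a b c)
  then show ?case by (simp add: Apow_add twist_otens_left)
qed (use zigzag_left zigzag_right eps_twist twist_eta in \<open>simp_all del: opow.simps(2)\<close>)

definition F_arr :: "tm set \<Rightarrow> 'a" where
  "F_arr X = ev (SOME f. f \<in> X)"

lemma F_arr_tcls: "typed n f a b \<Longrightarrow> F_arr (tcls n f) = ev f"
  unfolding F_arr_def tcls_def using ev_teq teq_refl[of n f a b] by (metis mem_Collect_eq someI_ex)

lemma F_arr_gens:
  "F_arr (gen_eta n) = \<eta>" "F_arr (gen_eps n) = \<epsilon>" "F_arr (gen_R n) = R" "F_arr (gen_S n) = S"
  by (simp_all add: gen_eta_def gen_eps_def gen_R_def gen_S_def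
      F_arr_tcls[OF ty_eta] F_arr_tcls[OF ty_eps] F_arr_tcls[OF ty_R] F_arr_tcls[OF ty_S])

lemma F_functor: "strict_braided_functor (Tangle n) C Apow F_arr"
proof
  show "\<And>f a b. f \<in> Hom (Tangle n) a b \<Longrightarrow> F_arr f \<in> Hom C (Apow a) (Apow b)"
    by (elim Tangle_HomE) (simp add: F_arr_tcls ev_hom)
  show "\<And>a. a \<in> Obj (Tangle n) \<Longrightarrow> F_arr (Idt (Tangle n) a) = Idt C (Apow a)"
    by (simp add: F_arr_tcls[OF ty_id])
  show "\<And>f b c g a. f \<in> Hom (Tangle n) b c \<Longrightarrow> g \<in> Hom (Tangle n) a b
      \<Longrightarrow> F_arr (f \<cdot>\<^bsub>Tangle n\<^esub> g) = F_arr f \<cdot> F_arr g"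
    by (elim Tangle_HomE) (simp add: comp_tcls F_arr_tcls F_arr_tcls[OF ty_comp])
  show "\<And>f a b g c d. f \<in> Hom (Tangle n) a b \<Longrightarrow> g \<in> Hom (Tangle n) c d
      \<Longrightarrow> F_arr (f \<boxtimes>\<^bsub>Tangle n\<^esub> g) = F_arr f \<boxtimes> F_arr g"
    by (elim Tangle_HomE) (simp add: tens_tcls F_arr_tcls F_arr_tcls[OF ty_tens])
  show "\<And>a b. a \<in> Obj (Tangle n) \<Longrightarrow> b \<in> Obj (Tangle n)
      \<Longrightarrow> F_arr (Twist (Tangle n) a b) = Twist C (Apow a) (Apow b)"
    by (simp add: F_arr_tcls[OF ty_twist])
qed (auto simp: Apow_add)

lemma F_unique:
  assumes F: "strict_braided_functor (Tangle n) C G0 G1"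
    and G: "G0 gen_A = A" "G1 (gen_eta n) = \<eta>" "G1 (gen_eps n) = \<epsilon>" "G1 (gen_R n) = R" "G1 (gen_S n) = S"
  shows "G0 k = Apow k" and "X \<in> Hom (Tangle n) a b \<Longrightarrow> G1 X = F_arr X"
proof -
  interpret G: strict_braided_functor "Tangle n" C G0 G1 by (rule F)
  have G0: "G0 k = Apow k" for k
  proof (induction k)
    case 0
    show ?case using G.F_unit by simp
  next
    case (Suc k)
    then show ?case using G.F_otens[of 1 k] G(1) by simp
  qed
  then show "G0 k = Apow k" .
  have ev: "G1 (tcls n f) = ev f" if "typed n f a b" for f a b
    using that
  proof (induction rule: typed.induct)
    case (ty_id a)
    then show ?case using G.F_id[of a] G0 by simp
  next
    case (ty_comp f b c g a)
    then show ?case using G.F_comp[OF Tangle_HomI Tangle_HomI] by (simp flip: comp_tcls)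
  next
    case (ty_tens f a b g c d)
    then show ?case using G.F_tens[OF Tangle_HomI Tangle_HomI] by (simp flip: tens_tcls)
  next
    case (ty_twist a b)
    then show ?case using G.F_twist[of a b] G0 by simp
  next
    case (ty_untwist a b)
    have c: "G1 (tcls n (TUntwist a b)) \<cdot> G1 (tcls n (TTwist a b)) = Idt C (G0 (a + b))"
      using G.F_comp[OF Tangle_HomI[OF typed.ty_untwist] Tangle_HomI[OF typed.ty_twist], of a b]
        G.F_id[of "a + b"] Tangle_twist_inverse[of n a b] by (simp add: is_inverse_def)
    have d: "G1 (tcls n (TTwist a b)) \<cdot> G1 (tcls n (TUntwist a b)) = Idt C (G0 (b + a))"
      using G.F_comp[OF Tangle_HomI[OF typed.ty_twist] Tangle_HomI[OF typed.ty_untwist], of a b]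
        G.F_id[of "b + a"] Tangle_twist_inverse[of n a b] by (simp add: is_inverse_def)
    have "is_inverse C (Apow a \<boxdot> Apow b) (Apow b \<boxdot> Apow a) (Twist C (Apow a) (Apow b))
        (G1 (tcls n (TUntwist a b)))"
      using c d G.F_twist[of a b] G0 G.F_hom[OF Tangle_HomI[OF typed.ty_untwist], of a b]
      by (simp add: is_inverse_def Apow_add)
    then show ?case by (simp add: inv_arrow_eqI twist_hom)
  qed (use G in \<open>simp_all add: gen_eta_def gen_eps_def gen_R_def gen_S_def\<close>)
  show "G1 X = F_arr X" if "X \<in> Hom (Tangle n) a b"
    using that by (elim Tangle_HomE) (simp add: ev F_arr_tcls)
qed

end



section \<open>Braids\<close>

inductive_set layers :: "('o, 'a, 'z) bsm_scheme \<Rightarrow> 'o \<Rightarrow> (nat \<times> 'a) set"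
  for C :: "('o, 'a, 'z) bsm_scheme" and A :: 'o where
  layer_id: "(k, Idt C (opow C A k)) \<in> layers C A"
| layer_twist: "(2, Twist C A A) \<in> layers C A"
| layer_untwist: "(2, inv_arrow C (A \<boxdot>\<^bsub>C\<^esub> A) (A \<boxdot>\<^bsub>C\<^esub> A) (Twist C A A)) \<in> layers C A"
| layer_tens: "\<lbrakk>(j, f) \<in> layers C A; (k, g) \<in> layers C A\<rbrakk>
    \<Longrightarrow> (j + k, f \<boxtimes>\<^bsub>C\<^esub> g) \<in> layers C A"

definition comp_list :: "('o, 'a, 'z) bsm_scheme \<Rightarrow> 'o \<Rightarrow> 'a list \<Rightarrow> 'a" where
  "comp_list C a fs = foldr (Comp C) fs (Idt C a)"

definition braids :: "('o, 'a, 'z) bsm_scheme \<Rightarrow> 'o \<Rightarrow> nat \<Rightarrow> 'a set" where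
  "braids C A n = {comp_list C (opow C A n) fs | fs. \<forall>f \<in> set fs. (n, f) \<in> layers C A}"

definition sigma :: "('o, 'a, 'z) bsm_scheme \<Rightarrow> 'o \<Rightarrow> nat \<Rightarrow> nat \<Rightarrow> 'a" where
  "sigma C A n i =
     Idt C (opow C A (i - 1)) \<boxtimes>\<^bsub>C\<^esub> Twist C A A \<boxtimes>\<^bsub>C\<^esub> Idt C (opow C A (n - i - 1))"

text \<open>\<open>half_twist C A n\<close> is \<open>(\<sigma>_1)(\<sigma>_2 \<sigma>_1)\<dots>(\<sigma>_(n-1) \<sigma>_(n-2) \<dots> \<sigma>_1)\<close>; the inner list is
  \<open>[\<sigma>_j, \<sigma>_(j-1), \<dots>, \<sigma>_1]\<close>.\<close>

definition half_twist :: "('o, 'a, 'z) bsm_scheme \<Rightarrow> 'o \<Rightarrow> nat \<Rightarrow> 'a" where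
  "half_twist C A n = comp_list C (opow C A n)
     (map (\<lambda>j. comp_list C (opow C A n) (map (sigma C A n) (rev [1..<Suc j]))) [1..<n])"


section \<open>The blocked-braid group\<close>

abbreviation Tbraids :: "nat \<Rightarrow> tm set set" where
  "Tbraids n \<equiv> braids (Tangle n) gen_A n"

definition blocked :: "nat \<Rightarrow> tm set \<Rightarrow> tm set" where
  "blocked n B = gen_S n \<cdot>\<^bsub>Tangle n\<^esub> B \<cdot>\<^bsub>Tangle n\<^esub> gen_R n"

text \<open>The product is well defined by \<open>blocked_cong\<close>; see also \<open>BB_mult\<close>, \<open>BB_group\<close> and
  \<open>BB_inv\<close>.\<close>

definition BB :: "nat \<Rightarrow> tm set monoid" where
  "BB n = \<lparr>
     carrier = blocked n ` Tbraids n,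
     mult = (\<lambda>x y. THE z. \<exists>B\<in>Tbraids n. \<exists>B'\<in>Tbraids n.
               x = blocked n B \<and> y = blocked n B' \<and> z = blocked n (B \<cdot>\<^bsub>Tangle n\<^esub> B')),
     one = blocked n (Idt (Tangle n) (opow (Tangle n) gen_A n))\<rparr>"

lemma Tangle_comp_hom:
  "\<lbrakk>f \<in> Hom (Tangle n) b c; g \<in> Hom (Tangle n) a b\<rbrakk> \<Longrightarrow> f \<cdot>\<^bsub>Tangle n\<^esub> g \<in> Hom (Tangle n) a c"
  by (rule Tangle.comp_hom)

lemma inv_arrow_twist: "inv_arrow (Tangle n) 2 2 (tcls n (TTwist 1 1)) = tcls n (TUntwist 1 1)"
  using Tangle.inv_arrow_eqI[OF Tangle_HomI[OF ty_twist] Tangle_twist_inverse, of n 1 1]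
  by (simp add: numeral_2_eq_2)

lemma Tangle_layers_hom:
  assumes "(k, f) \<in> layers (Tangle n) gen_A"
  shows "f \<in> Hom (Tangle n) k k"
  using assms
proof (induction k f rule: layers.induct)
  case (layer_id k)
  show ?case by (simp add: Tangle_HomI ty_id del: opow.simps)
next
  case layer_twist
  show ?case using Tangle_HomI[OF ty_twist, of n 1 1] by (simp add: numeral_2_eq_2)
next
  case layer_untwist
  show ?case using Tangle_HomI[OF ty_untwist, of n 1 1] inv_arrow_twist by (simp add: numeral_2_eq_2)
next
  case (layer_tens j f k g)
  then show ?case using Tangle.tens_hom by fastforce
qed

lemma Tangle_layers_inverse:
  assumes "(k, f) \<in> layers (Tangle n) gen_A"
  shows "\<exists>g. (k, g) \<in> layers (Tangle n) gen_A \<and> is_inverse (Tangle n) k k f g"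
  using assms
proof (induction k f rule: layers.induct)
  case (layer_id k)
  have "is_inverse (Tangle n) k k (tcls n (TId k)) (tcls n (TId k))"
    using Tangle.id_hom[of k n] Tangle.id_comp by (simp add: is_inverse_def)
  then show ?case using layers.layer_id[of k "Tangle n" gen_A] by auto
next
  case layer_twist
  then show ?case using layers.layer_untwist[of "Tangle n" gen_A] inv_arrow_twist
      Tangle_twist_inverse[of n 1 1] by (auto simp: numeral_2_eq_2)
next
  case layer_untwist
  have "is_inverse (Tangle n) 2 2 (tcls n (TUntwist 1 1)) (tcls n (TTwist 1 1))"
    using Tangle_twist_inverse[of n 1 1] Tangle_HomI[OF ty_twist, of n 1 1]
    by (simp add: is_inverse_def numeral_2_eq_2)
  then show ?case using layers.layer_twist[of "Tangle n" gen_A] inv_arrow_twist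
    by (auto simp: numeral_2_eq_2)
next
  case (layer_tens j f k g)
  then obtain f' g' where l: "(j, f') \<in> layers (Tangle n) gen_A" "(k, g') \<in> layers (Tangle n) gen_A"
    and i: "is_inverse (Tangle n) j j f f'" "is_inverse (Tangle n) k k g g'" by blast
  note h = Tangle_layers_hom[OF l(1)] Tangle_layers_hom[OF l(2)]
    Tangle_layers_hom[OF layer_tens.hyps(1)] Tangle_layers_hom[OF layer_tens.hyps(2)]
  have "is_inverse (Tangle n) (j + k) (j + k) (f \<boxtimes>\<^bsub>Tangle n\<^esub> g) (f' \<boxtimes>\<^bsub>Tangle n\<^esub> g')"
    using i Tangle.tens_hom[OF h(1,2)] Tangle.interchange[OF h(1,3,2,4)]
      Tangle.interchange[OF h(3,1,4,2)] Tangle.tens_id[of j n k]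
    by (simp add: is_inverse_def)
  then show ?case using layers.layer_tens[OF l] by blast
qed

lemma Tbraids_altI:
  "\<lbrakk>(n, f) \<in> layers (Tangle n) gen_A; B \<in> Tbraids n\<rbrakk> \<Longrightarrow> f \<cdot>\<^bsub>Tangle n\<^esub> B \<in> Tbraids n"
  unfolding braids_def comp_list_def
  by (clarsimp simp del: opow.simps) (rule_tac x="f # fs" in exI, simp)

lemma Tbraids_id: "tcls n (TId n) \<in> Tbraids n"
  unfolding braids_def comp_list_def by (force intro: exI[of _ "[]"])

lemma Tbraids_induct [consumes 1, case_names id step]:
  assumes "B \<in> Tbraids n"
    and "P (tcls n (TId n))"
    and "\<And>f B. \<lbrakk>(n, f) \<in> layers (Tangle n) gen_A; B \<in> Tbraids n; P B\<rbrakk> \<Longrightarrow> P (f \<cdot>\<^bsub>Tangle n\<^esub> B)"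
  shows "P B"
proof -
  have "P (comp_list (Tangle n) n fs) \<and> comp_list (Tangle n) n fs \<in> Tbraids n"
    if "\<forall>f \<in> set fs. (n, f) \<in> layers (Tangle n) gen_A" for fs
    using that
    by (induction fs) (use assms(2,3) Tbraids_altI Tbraids_id in \<open>auto simp: comp_list_def\<close>)
  then show ?thesis using assms(1) unfolding braids_def by auto
qed

lemma Tbraids_hom: "B \<in> Tbraids n \<Longrightarrow> B \<in> Hom (Tangle n) n n"
  by (induction rule: Tbraids_induct)
    (blast intro: Tangle_HomI ty_id Tangle_comp_hom Tangle_layers_hom)+

lemma Tbraids_comp:
  assumes "B \<in> Tbraids n" "B' \<in> Tbraids n"
  shows "B \<cdot>\<^bsub>Tangle n\<^esub> B' \<in> Tbraids n"
  using assms(1)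
proof (induction rule: Tbraids_induct)
  case id
  then show ?case using Tangle.id_comp[OF Tbraids_hom[OF assms(2)]] assms(2) by simp
next
  case (step f B)
  then show ?case
    using Tangle.comp_assoc[OF Tangle_layers_hom[OF step(1)] Tbraids_hom[OF step(2)]
        Tbraids_hom[OF assms(2)]] Tbraids_altI by simp
qed

lemma layers_Tbraids: "(n, f) \<in> layers (Tangle n) gen_A \<Longrightarrow> f \<in> Tbraids n"
  using Tbraids_altI[OF _ Tbraids_id] Tangle.comp_id[OF Tangle_layers_hom] by fastforce

lemma Tbraids_comp_list:
  assumes "set Bs \<subseteq> Tbraids n"
  shows "comp_list (Tangle n) n Bs \<in> Tbraids n"
  using assms
proof (induction Bs)
  case Nil
  then show ?case using Tbraids_id[of n] by (simp add: comp_list_def)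
next
  case (Cons B Bs)
  then have "B \<cdot>\<^bsub>Tangle n\<^esub> comp_list (Tangle n) n Bs \<in> Tbraids n"
    using Tbraids_comp[of B n] by simp
  then show ?case by (simp add: comp_list_def)
qed

lemma sigma_Tbraids:
  assumes "1 \<le> i" "i < n"
  shows "sigma (Tangle n) gen_A n i \<in> Tbraids n"
proof -
  have "(i - 1 + 2 + (n - i - 1), sigma (Tangle n) gen_A n i) \<in> layers (Tangle n) gen_A"
    unfolding sigma_def by (intro layers.intros)
  moreover have "i - 1 + 2 + (n - i - 1) = n" using assms by simp
  ultimately show ?thesis using layers_Tbraids by metis
qed

lemma half_twist_Tbraids: "half_twist (Tangle n) gen_A n \<in> Tbraids n"
  unfolding half_twist_def opow_Tangle
proof (rule Tbraids_comp_list, safe)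
  fix B assume "B \<in> set (map (\<lambda>j. comp_list (Tangle n) n
      (map (sigma (Tangle n) gen_A n) (rev [1..<Suc j]))) [1..<n])"
  then obtain j where j: "j < n"
    and B: "B = comp_list (Tangle n) n (map (sigma (Tangle n) gen_A n) (rev [1..<Suc j]))"
    by auto
  have "set (map (sigma (Tangle n) gen_A n) (rev [1..<Suc j])) \<subseteq> Tbraids n"
    using j sigma_Tbraids[of _ n] by (auto simp del: upt_Suc)
  then show "B \<in> Tbraids n" unfolding B by (rule Tbraids_comp_list)
qed

lemma Tbraids_inverse:
  assumes "B \<in> Tbraids n"
  shows "inv_arrow (Tangle n) n n B \<in> Tbraids n"
    and "is_inverse (Tangle n) n n B (inv_arrow (Tangle n) n n B)"
proof -
  have "\<exists>g \<in> Tbraids n. is_inverse (Tangle n) n n B g"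
    using assms
  proof (induction rule: Tbraids_induct)
    case id
    have "is_inverse (Tangle n) n n (tcls n (TId n)) (tcls n (TId n))"
      using Tangle_HomI[OF ty_id, of n n] Tangle.id_comp[OF Tangle_HomI[OF ty_id], of n n]
      by (simp add: is_inverse_def)
    then show ?case using Tbraids_id by blast
  next
    case (step f B)
    then obtain g where g: "g \<in> Tbraids n" "is_inverse (Tangle n) n n B g" by blast
    obtain f' where f': "(n, f') \<in> layers (Tangle n) gen_A" "is_inverse (Tangle n) n n f f'"
      using Tangle_layers_inverse[OF step(1)] by blast
    note h = Tangle_layers_hom[OF step(1)] Tangle_layers_hom[OF f'(1)] Tbraids_hom[OF step(2)]
      Tbraids_hom[OF g(1)]
    let ?c = "Comp (Tangle n)"
    have 1: "?c (?c g f') (?c f B) = tcls n (TId n)"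
    proof -
      have "?c (?c g f') (?c f B) = ?c g (?c (?c f' f) B)"
        using Tangle.comp_assoc[OF h(4) h(2) Tangle_comp_hom[OF h(1,3)]]
          Tangle.comp_assoc[OF h(2,1,3)] by simp
      then show ?thesis using f'(2) g(2) Tangle.id_comp[OF h(3)] by (simp add: is_inverse_def)
    qed
    have 2: "?c (?c f B) (?c g f') = tcls n (TId n)"
    proof -
      have "?c (?c f B) (?c g f') = ?c f (?c (?c B g) f')"
        using Tangle.comp_assoc[OF h(1) h(3) Tangle_comp_hom[OF h(4,2)]]
          Tangle.comp_assoc[OF h(3,4,2)] by simp
      then show ?thesis using f'(2) g(2) Tangle.id_comp[OF h(2)] by (simp add: is_inverse_def)
    qed
    have "is_inverse (Tangle n) n n (?c f B) (?c g f')"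
      using 1 2 Tangle_comp_hom[OF h(4,2)] by (simp add: is_inverse_def)
    then show ?case using Tbraids_comp[OF g(1) layers_Tbraids[OF f'(1)]] by blast
  qed
  then obtain g where g: "g \<in> Tbraids n" "is_inverse (Tangle n) n n B g" by blast
  then have "inv_arrow (Tangle n) n n B = g"
    using Tangle.inv_arrow_eqI Tbraids_hom[OF assms] by blast
  then show "inv_arrow (Tangle n) n n B \<in> Tbraids n"
    "is_inverse (Tangle n) n n B (inv_arrow (Tangle n) n n B)" using g by auto
qed

lemma F_arr_fixes_braid:
  assumes "tangle_model (Tangle n) gen_A (gen_eta n) (gen_eps n) n R S" and "B \<in> Tbraids n"
  shows "tangle_model.F_arr (Tangle n) gen_A (gen_eta n) (gen_eps n) R S B = B"
proof -
  interpret M: tangle_model "Tangle n" gen_A "gen_eta n" "gen_eps n" n R S by (rule assms(1))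
  interpret F: strict_braided_functor "Tangle n" "Tangle n" "opow (Tangle n) gen_A" M.F_arr
    by (rule M.F_functor)
  have l: "M.F_arr f = f" if "(k, f) \<in> layers (Tangle n) gen_A" for k f
    using that
  proof (induction k f rule: layers.induct)
    case (layer_id k)
    show ?case using F.F_id[of k] by (simp del: opow.simps)
  next
    case layer_twist
    show ?case using F.F_twist[of 1 1] by (simp del: opow.simps One_nat_def)
  next
    case layer_untwist
    have "M.F_arr (tcls n (TUntwist 1 1)) = tcls n (TUntwist 1 1)"
      using inv_arrow_twist[of n] M.F_arr_tcls[OF ty_untwist[of n 1 1]]
      by (simp add: numeral_2_eq_2 del: opow.simps)
    then show ?case using inv_arrow_twist[of n] by (simp add: numeral_2_eq_2)
  next
    case (layer_tens j f k g)
    then show ?case using F.F_tens[OF Tangle_layers_hom Tangle_layers_hom] by simp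
  qed
  show ?thesis using assms(2)
  proof (induction rule: Tbraids_induct)
    case id
    then show ?case using F.F_id[of n] by (simp del: opow.simps)
  next
    case (step f B)
    then show ?case using F.F_comp[OF Tangle_layers_hom[OF step(1)] Tbraids_hom[OF step(2)]] l by simp
  qed
qed

lemma blocked_cong_right:
  assumes B: "B \<in> Tbraids n" "B1 \<in> Tbraids n" "D \<in> Tbraids n" and eq: "blocked n B = blocked n B1"
  shows "blocked n (B \<cdot>\<^bsub>Tangle n\<^esub> D) = blocked n (B1 \<cdot>\<^bsub>Tangle n\<^esub> D)"
proof -
  note h = B[THEN Tbraids_hom] Tangle_gens[of n]
  have m: "tangle_model (Tangle n) gen_A (gen_eta n) (gen_eps n) n (D \<cdot>\<^bsub>Tangle n\<^esub> gen_R n) (gen_S n)"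
    using h by (intro Tangle_tangle_model Tangle_comp_hom)
  interpret M: tangle_model "Tangle n" gen_A "gen_eta n" "gen_eps n" n "D \<cdot>\<^bsub>Tangle n\<^esub> gen_R n" "gen_S n"
    by (rule m)
  interpret F: strict_braided_functor "Tangle n" "Tangle n" "opow (Tangle n) gen_A" M.F_arr
    by (rule M.F_functor)
  have "M.F_arr (blocked n E) = blocked n (E \<cdot>\<^bsub>Tangle n\<^esub> D)" if E: "E \<in> Tbraids n" for E
  proof -
    note e = Tbraids_hom[OF E]
    have "M.F_arr (blocked n E) = gen_S n \<cdot>\<^bsub>Tangle n\<^esub> E \<cdot>\<^bsub>Tangle n\<^esub> (D \<cdot>\<^bsub>Tangle n\<^esub> gen_R n)"
      unfolding blocked_def
      using F.F_comp[OF Tangle_comp_hom[OF h(7) e] h(6)] F.F_comp[OF h(7) e] M.F_arr_gens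
        F_arr_fixes_braid[OF m E] by simp
    also have "\<dots> = blocked n (E \<cdot>\<^bsub>Tangle n\<^esub> D)"
      unfolding blocked_def
      using Tangle.comp_assoc[OF Tangle_comp_hom[OF h(7) e] h(3,6)]
        Tangle.comp_assoc[OF h(7) e h(3)] by simp
    finally show ?thesis .
  qed
  then show ?thesis using B eq by metis
qed

lemma blocked_cong_left:
  assumes B: "B \<in> Tbraids n" "B1 \<in> Tbraids n" "D \<in> Tbraids n" and eq: "blocked n B = blocked n B1"
  shows "blocked n (D \<cdot>\<^bsub>Tangle n\<^esub> B) = blocked n (D \<cdot>\<^bsub>Tangle n\<^esub> B1)"
proof -
  note h = B[THEN Tbraids_hom] Tangle_gens[of n]
  have m: "tangle_model (Tangle n) gen_A (gen_eta n) (gen_eps n) n (gen_R n) (gen_S n \<cdot>\<^bsub>Tangle n\<^esub> D)"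
    using h by (intro Tangle_tangle_model Tangle_comp_hom)
  interpret M: tangle_model "Tangle n" gen_A "gen_eta n" "gen_eps n" n "gen_R n" "gen_S n \<cdot>\<^bsub>Tangle n\<^esub> D"
    by (rule m)
  interpret F: strict_braided_functor "Tangle n" "Tangle n" "opow (Tangle n) gen_A" M.F_arr
    by (rule M.F_functor)
  have "M.F_arr (blocked n E) = blocked n (D \<cdot>\<^bsub>Tangle n\<^esub> E)" if E: "E \<in> Tbraids n" for E
  proof -
    note e = Tbraids_hom[OF E]
    have "M.F_arr (blocked n E) = gen_S n \<cdot>\<^bsub>Tangle n\<^esub> D \<cdot>\<^bsub>Tangle n\<^esub> E \<cdot>\<^bsub>Tangle n\<^esub> gen_R n"
      unfolding blocked_def
      using F.F_comp[OF Tangle_comp_hom[OF h(7) e] h(6)] F.F_comp[OF h(7) e] M.F_arr_gens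
        F_arr_fixes_braid[OF m E] by simp
    also have "\<dots> = blocked n (D \<cdot>\<^bsub>Tangle n\<^esub> E)"
      unfolding blocked_def using Tangle.comp_assoc[OF h(7,3) e] by simp
    finally show ?thesis .
  qed
  then show ?thesis using B eq by metis
qed

lemma blocked_cong:
  assumes "B \<in> Tbraids n" "B1 \<in> Tbraids n" "D \<in> Tbraids n" "D1 \<in> Tbraids n"
    and "blocked n B = blocked n B1" "blocked n D = blocked n D1"
  shows "blocked n (B \<cdot>\<^bsub>Tangle n\<^esub> D) = blocked n (B1 \<cdot>\<^bsub>Tangle n\<^esub> D1)"
  using blocked_cong_right[of B n B1 D] blocked_cong_left[of D n D1 B1] assms by simp

lemma BB_mult:
  assumes "B \<in> Tbraids n" "B' \<in> Tbraids n"
  shows "blocked n B \<otimes>\<^bsub>BB n\<^esub> blocked n B' = blocked n (B \<cdot>\<^bsub>Tangle n\<^esub> B')"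
proof -
  have "(THE z. \<exists>D\<in>Tbraids n. \<exists>D'\<in>Tbraids n. blocked n B = blocked n D \<and>
          blocked n B' = blocked n D' \<and> z = blocked n (D \<cdot>\<^bsub>Tangle n\<^esub> D'))
      = blocked n (B \<cdot>\<^bsub>Tangle n\<^esub> B')"
  proof (rule the_equality)
    show "\<exists>D\<in>Tbraids n. \<exists>D'\<in>Tbraids n. blocked n B = blocked n D \<and> blocked n B' = blocked n D' \<and>
        blocked n (B \<cdot>\<^bsub>Tangle n\<^esub> B') = blocked n (D \<cdot>\<^bsub>Tangle n\<^esub> D')"
      using assms by blast
  next
    fix z
    assume "\<exists>D\<in>Tbraids n. \<exists>D'\<in>Tbraids n. blocked n B = blocked n D \<and>
        blocked n B' = blocked n D' \<and> z = blocked n (D \<cdot>\<^bsub>Tangle n\<^esub> D')"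
    then show "z = blocked n (B \<cdot>\<^bsub>Tangle n\<^esub> B')"
      using blocked_cong[OF assms(1) _ assms(2)] by force
  qed
  then show ?thesis unfolding BB_def monoid.simps partial_object.simps .
qed

lemma BB_one: "\<one>\<^bsub>BB n\<^esub> = blocked n (tcls n (TId n))"
  by (simp add: BB_def del: opow.simps)

lemma BB_carrier: "carrier (BB n) = blocked n ` Tbraids n"
  by (simp add: BB_def)

lemma BB_inverse:
  assumes "B \<in> Tbraids n"
  shows "blocked n (inv_arrow (Tangle n) n n B) \<otimes>\<^bsub>BB n\<^esub> blocked n B = \<one>\<^bsub>BB n\<^esub>"
  unfolding BB_mult[OF Tbraids_inverse(1)[OF assms] assms] BB_one
  using Tbraids_inverse(2)[OF assms] by (simp add: is_inverse_def)

theorem BB_group: "group (BB n)"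
proof (rule groupI)
  fix x y assume "x \<in> carrier (BB n)" "y \<in> carrier (BB n)"
  then obtain B B' where "B \<in> Tbraids n" "B' \<in> Tbraids n" "x = blocked n B" "y = blocked n B'"
    unfolding BB_carrier by blast
  then show "x \<otimes>\<^bsub>BB n\<^esub> y \<in> carrier (BB n)"
    unfolding BB_carrier using BB_mult Tbraids_comp by blast
next
  show "\<one>\<^bsub>BB n\<^esub> \<in> carrier (BB n)"
    unfolding BB_carrier BB_one using Tbraids_id by blast
next
  fix x y z assume "x \<in> carrier (BB n)" "y \<in> carrier (BB n)" "z \<in> carrier (BB n)"
  then obtain B B' B'' where B: "B \<in> Tbraids n" "B' \<in> Tbraids n" "B'' \<in> Tbraids n"
    and x: "x = blocked n B" "y = blocked n B'" "z = blocked n B''"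
    unfolding BB_carrier by blast
  show "x \<otimes>\<^bsub>BB n\<^esub> y \<otimes>\<^bsub>BB n\<^esub> z = x \<otimes>\<^bsub>BB n\<^esub> (y \<otimes>\<^bsub>BB n\<^esub> z)"
    unfolding x BB_mult[OF B(1,2)] BB_mult[OF B(2,3)] BB_mult[OF Tbraids_comp[OF B(1,2)] B(3)]
      BB_mult[OF B(1) Tbraids_comp[OF B(2,3)]] Tangle.comp_assoc[OF B[THEN Tbraids_hom]] ..
next
  fix x assume "x \<in> carrier (BB n)"
  then obtain B where B: "B \<in> Tbraids n" and x: "x = blocked n B"
    unfolding BB_carrier by blast
  show "\<one>\<^bsub>BB n\<^esub> \<otimes>\<^bsub>BB n\<^esub> x = x"
    using Tangle.id_comp[OF Tbraids_hom[OF B]] unfolding x BB_one BB_mult[OF Tbraids_id B] by simp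
  show "\<exists>y\<in>carrier (BB n). y \<otimes>\<^bsub>BB n\<^esub> x = \<one>\<^bsub>BB n\<^esub>"
    unfolding x BB_carrier using BB_inverse[OF B] Tbraids_inverse(1)[OF B] by blast
qed

lemma BB_inv: "B \<in> Tbraids n \<Longrightarrow> inv\<^bsub>BB n\<^esub> (blocked n B) = blocked n (inv_arrow (Tangle n) n n B)"
  using group.inv_equality[OF BB_group BB_inverse] Tbraids_inverse(1) BB_carrier by blast

end

theory Submission
  imports Defs
begin

text \<open>
  Write \<open>d = \<sigma>_(n-1) \<dots> \<sigma>_1\<close> for the braid carrying the first string over to the last place and
  \<open>u = \<sigma>_1 \<dots> \<sigma>_(n-1)\<close> for the one carrying the last string to the first place. In the free
  braided category these are the twists of \<open>A\<close> with \<open>A^(n-1)\<close> in the two orders, so \<open>du\<close> drags one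
  string once around all the others.

  Topology enters only through the fact that the box \<open>R\<close> absorbs such a turn
  (\<open>monodromy_absorbed\<close>): \<open>R = (r \<otimes> 1)\<eta>\<close>, where \<open>r\<close> is \<open>R\<close> with one of its strings bent round, and
  by naturality the double twist slides past \<open>r\<close> to \<open>\<eta>\<close>, which is invariant under the twist. Thus
  \<open>du = 1\<close> in the blocked-braid group (\<open>BB_sphere_relation\<close>). This is the extra relation of the
  braid group of the sphere, whose elements are the braids in the shell between the two boxes.

  The rest is algebra of braid generators in a group. The half twist \<open>t\<close> satisfies \<open>td = ut\<close>, and
  \<open>d^n = t^2\<close> is the full twist (\<open>down_pow_full_twist\<close>). If \<open>du = 1\<close>, these give
  \<open>t t^2 = t d^n = u^n t\<close>, hence \<open>t^2 = u^n = d^(-n) = t^(-2)\<close> and \<open>t^4 = 1\<close>.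
\<close>


section \<open>Braid generators in a group\<close>

context monoid
begin

definition lprod :: "'a list \<Rightarrow> 'a" where
  "lprod xs = foldr (\<otimes>) xs \<one>"

lemma lprod_simps [simp]: "lprod [] = \<one>" "lprod (x # xs) = x \<otimes> lprod xs"
  by (simp_all add: lprod_def)

lemma lprod_closed [simp]: "set xs \<subseteq> carrier G \<Longrightarrow> lprod xs \<in> carrier G"
  by (induction xs) auto

lemma lprod_append:
  "\<lbrakk>set xs \<subseteq> carrier G; set ys \<subseteq> carrier G\<rbrakk> \<Longrightarrow> lprod (xs @ ys) = lprod xs \<otimes> lprod ys"
  by (induction xs) (auto simp: m_assoc)

text \<open>The workhorse of the braid algebra: commutation with all factors of a product, and the
  shifting of indices caused by moving a braid past a product, are both instances.\<close>

lemma lprod_intertwine: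
  assumes "z \<in> carrier G" "f ` set is \<subseteq> carrier G" "g ` set is \<subseteq> carrier G"
    and "\<And>i. i \<in> set is \<Longrightarrow> z \<otimes> f i = g i \<otimes> z"
  shows "z \<otimes> lprod (map f is) = lprod (map g is) \<otimes> z"
  using assms
proof (induction "is")
  case (Cons i "is")
  then have c: "f i \<in> carrier G" "g i \<in> carrier G" "lprod (map f is) \<in> carrier G"
    "lprod (map g is) \<in> carrier G" by auto
  have "z \<otimes> lprod (map f (i # is)) = g i \<otimes> (z \<otimes> lprod (map f is))"
    using Cons.prems c by (simp flip: m_assoc)
  then show ?case using Cons c by (simp add: m_assoc)
qed simp

lemma pow_intertwine:
  assumes "x \<in> carrier G" "y \<in> carrier G" "z \<in> carrier G" "z \<otimes> x = y \<otimes> z"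
  shows "z \<otimes> x [^] (k::nat) = y [^] k \<otimes> z"
proof (induction k)
  case (Suc k)
  have "z \<otimes> x [^] Suc k = (z \<otimes> x [^] k) \<otimes> x" using assms by (simp add: m_assoc)
  also have "\<dots> = y [^] k \<otimes> (z \<otimes> x)" using Suc assms by (simp add: m_assoc)
  also have "\<dots> = y [^] Suc k \<otimes> z" using assms by (simp add: m_assoc)
  finally show ?case .
qed (use assms in simp)

end

locale braid_generators = group G for G (structure) +
  fixes n :: nat and s :: "nat \<Rightarrow> 'a"
  assumes s_closed: "\<lbrakk>1 \<le> i; i < n\<rbrakk> \<Longrightarrow> s i \<in> carrier G"
    and far_commute: "\<lbrakk>1 \<le> i; Suc i < j; j < n\<rbrakk> \<Longrightarrow> s i \<otimes> s j = s j \<otimes> s i"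
    and braid_relation: "\<lbrakk>1 \<le> i; Suc i < n\<rbrakk> \<Longrightarrow>
      s i \<otimes> (s (Suc i) \<otimes> s i) = s (Suc i) \<otimes> (s i \<otimes> s (Suc i))"
begin

text \<open>\<open>up i k\<close> is \<open>s_i \<dots> s_k\<close> and \<open>down k\<close> is \<open>s_k \<dots> s_1\<close>. The element \<open>garside k\<close>, the product
  \<open>down 1 \<dots> down k\<close>, is Garside's half twist on the first \<open>k + 1\<close> strings; note the difference
  of one between the index and the number of strings.\<close>

definition up :: "nat \<Rightarrow> nat \<Rightarrow> 'a" where
  "up i k = lprod (map s [i..<Suc k])"

definition down :: "nat \<Rightarrow> 'a" where
  "down k = lprod (map s (rev [1..<Suc k]))"

definition garside :: "nat \<Rightarrow> 'a" where
  "garside k = lprod (map down [1..<Suc k])"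

(* The first generator has index 1; the normal form Suc 0 would hide instances of "up 1". *)
context
  notes [simp del] = One_nat_def
begin

lemma down_closed [simp]: "k < n \<Longrightarrow> down k \<in> carrier G"
  unfolding down_def by (rule lprod_closed) (auto simp: s_closed)

lemma up_closed [simp]: "\<lbrakk>1 \<le> i; k < n\<rbrakk> \<Longrightarrow> up i k \<in> carrier G"
  unfolding up_def by (rule lprod_closed) (auto simp: s_closed)

lemma garside_closed [simp]: "k < n \<Longrightarrow> garside k \<in> carrier G"
  unfolding garside_def by (rule lprod_closed) (auto simp del: upt_Suc)

lemma down_0 [simp]: "down 0 = \<one>" and garside_0 [simp]: "garside 0 = \<one>"
  by (simp_all add: down_def garside_def)

lemma up_empty [simp]: "k < i \<Longrightarrow> up i k = \<one>"
  by (simp add: up_def)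

lemma down_Suc: "down (Suc k) = s (Suc k) \<otimes> down k"
  by (simp add: down_def)

lemma up_Suc: "\<lbrakk>1 \<le> i; i \<le> Suc k; Suc k < n\<rbrakk> \<Longrightarrow> up i (Suc k) = up i k \<otimes> s (Suc k)"
  unfolding up_def
  by (subst upt_Suc_append) (auto simp: s_closed lprod_append image_subset_iff simp del: upt_Suc)

lemma garside_Suc: "Suc k < n \<Longrightarrow> garside (Suc k) = garside k \<otimes> down (Suc k)"
  unfolding garside_def
  by (subst upt_Suc_append) (auto simp: lprod_append image_subset_iff simp del: upt_Suc)

lemma s_down_commute: "\<lbrakk>Suc k < j; j < n\<rbrakk> \<Longrightarrow> s j \<otimes> down k = down k \<otimes> s j"
  unfolding down_def by (rule lprod_intertwine) (auto simp: s_closed intro: far_commute[symmetric])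

lemma s_up_commute: "\<lbrakk>Suc k < j; j < n\<rbrakk> \<Longrightarrow> s j \<otimes> up 1 k = up 1 k \<otimes> s j"
  unfolding up_def by (rule lprod_intertwine) (auto simp: s_closed intro: far_commute[symmetric])

lemma s_garside_commute: "\<lbrakk>Suc k < j; j < n\<rbrakk> \<Longrightarrow> s j \<otimes> garside k = garside k \<otimes> s j"
  unfolding garside_def
  by (rule lprod_intertwine) (auto simp: s_closed s_down_commute simp del: upt_Suc)

text \<open>Dragging a string across the others moves a crossing among them by one place; the braid
  relation enters where the crossing meets the factors \<open>s_(i+1) s_i\<close> of \<open>down k\<close>, and the other factors commute
  with it.\<close>

lemma down_s: "\<lbrakk>1 \<le> i; i < k; k < n\<rbrakk> \<Longrightarrow> down k \<otimes> s (Suc i) = s i \<otimes> down k"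
proof (induction k)
  case (Suc k)
  then have c: "s i \<in> carrier G" "s (Suc i) \<in> carrier G" "s (Suc k) \<in> carrier G" "down k \<in> carrier G"
    by (auto simp: s_closed)
  show ?case
  proof (cases "i = k")
    case True
    then obtain j where k: "k = Suc j" using Suc.prems by (cases k) auto
    have j: "down j \<in> carrier G" using Suc.prems k by simp
    have "down (Suc k) \<otimes> s (Suc i) = s (Suc k) \<otimes> (s k \<otimes> (down j \<otimes> s (Suc k)))"
      using c j True k by (simp add: down_Suc m_assoc)
    also have "\<dots> = s (Suc k) \<otimes> (s k \<otimes> s (Suc k)) \<otimes> down j"
      using s_down_commute[of j "Suc k"] c j True k Suc.prems by (simp add: m_assoc)
    also have "\<dots> = s k \<otimes> (s (Suc k) \<otimes> s k) \<otimes> down j"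
      using braid_relation[of k] Suc.prems True by simp
    finally show ?thesis using c j True k by (simp add: down_Suc m_assoc)
  next
    case False
    have "down (Suc k) \<otimes> s (Suc i) = s (Suc k) \<otimes> s i \<otimes> down k"
      using False Suc c by (simp add: down_Suc m_assoc)
    then show ?thesis
      using far_commute[of i "Suc k"] False Suc.prems c by (simp add: down_Suc flip: m_assoc)
  qed
qed simp

lemma up_s: "\<lbrakk>1 \<le> i; i < k; k < n\<rbrakk> \<Longrightarrow> up 1 k \<otimes> s i = s (Suc i) \<otimes> up 1 k"
proof (induction k)
  case (Suc k)
  then have c: "s i \<in> carrier G" "s (Suc i) \<in> carrier G" "s (Suc k) \<in> carrier G" "up 1 k \<in> carrier G"
    by (auto simp: s_closed)
  have U: "up 1 (Suc k) = up 1 k \<otimes> s (Suc k)" using Suc.prems by (simp add: up_Suc)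
  show ?case
  proof (cases "i = k")
    case True
    then obtain j where k: "k = Suc j" using Suc.prems by (cases k) auto
    have j: "up 1 j \<in> carrier G" and Uk: "up 1 k = up 1 j \<otimes> s k"
      using Suc.prems k by (simp_all add: up_Suc)
    have "up 1 (Suc k) \<otimes> s i = up 1 j \<otimes> (s k \<otimes> (s (Suc k) \<otimes> s k))"
      using c j True by (simp add: U Uk m_assoc)
    also have "\<dots> = up 1 j \<otimes> (s (Suc k) \<otimes> (s k \<otimes> s (Suc k)))"
      using braid_relation[of k] Suc.prems True by simp
    also have "\<dots> = (s (Suc k) \<otimes> up 1 j) \<otimes> (s k \<otimes> s (Suc k))"
      using s_up_commute[of j "Suc k"] c j True k Suc.prems by (simp add: m_assoc)
    finally show ?thesis using c j True by (simp add: U Uk m_assoc)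
  next
    case False
    have "up 1 (Suc k) \<otimes> s i = up 1 k \<otimes> s i \<otimes> s (Suc k)"
      using far_commute[of i "Suc k"] False Suc.prems c by (simp add: U m_assoc)
    then show ?thesis using False Suc c by (simp add: U m_assoc)
  qed
qed simp

text \<open>\<open>down k up 1 k\<close> drags the last of \<open>k + 1\<close> strings once around the first \<open>k\<close>, so it commutes
  with every braid on those: one factor shifts the index up and the other shifts it back.\<close>

lemma down_up_s:
  assumes "1 \<le> i" "i < k" "k < n"
  shows "down k \<otimes> up 1 k \<otimes> s i = s i \<otimes> (down k \<otimes> up 1 k)"
proof -
  have c: "s i \<in> carrier G" "s (Suc i) \<in> carrier G" "down k \<in> carrier G" "up 1 k \<in> carrier G"
    using assms by (auto simp: s_closed)
  have "down k \<otimes> up 1 k \<otimes> s i = down k \<otimes> s (Suc i) \<otimes> up 1 k"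
    using up_s[OF assms] c by (simp add: m_assoc)
  then show ?thesis using down_s[OF assms] c by (simp add: m_assoc)
qed

lemma down_up_garside:
  assumes "Suc k < n"
  shows "down (Suc k) \<otimes> up 1 (Suc k) \<otimes> garside k = garside k \<otimes> (down (Suc k) \<otimes> up 1 (Suc k))"
proof -
  have "down (Suc k) \<otimes> up 1 (Suc k) \<otimes> down j = down j \<otimes> (down (Suc k) \<otimes> up 1 (Suc k))"
    if "j < Suc k" for j
    unfolding down_def[of j]
    by (rule lprod_intertwine) (use that assms down_up_s[of _ "Suc k"] in \<open>auto simp: s_closed\<close>)
  then show ?thesis
    unfolding garside_def
    by (intro lprod_intertwine) (use assms in \<open>auto simp del: upt_Suc\<close>)
qed

text \<open>The half twist also grows by a factor on the left. Together with \<open>garside_Suc\<close> this says that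
  conjugation by the half twist reverses the order of the strings, in the only instance needed:
  it carries \<open>down\<close> to \<open>up 1\<close>.\<close>

lemma garside_Suc': "Suc k < n \<Longrightarrow> garside (Suc k) = up 1 (Suc k) \<otimes> garside k"
proof (induction k)
  case 0
  then show ?case by (simp add: garside_Suc down_Suc up_Suc s_closed)
next
  case (Suc k)
  let ?s = "s (Suc (Suc k))"
  from Suc.prems have c: "?s \<in> carrier G" "garside k \<in> carrier G" "up 1 (Suc k) \<in> carrier G"
    "down (Suc k) \<in> carrier G" by (auto simp: s_closed)
  have "garside (Suc (Suc k)) = up 1 (Suc k) \<otimes> (garside k \<otimes> ?s) \<otimes> down (Suc k)"
    using Suc c by (simp add: garside_Suc[of "Suc k"] down_Suc[of "Suc k"] m_assoc)
  also have "\<dots> = up 1 (Suc k) \<otimes> (?s \<otimes> garside k) \<otimes> down (Suc k)"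
    using Suc.prems by (simp add: s_garside_commute)
  also have "\<dots> = (up 1 (Suc k) \<otimes> ?s) \<otimes> (garside k \<otimes> down (Suc k))"
    using c by (simp add: m_assoc)
  finally show ?case using Suc.prems by (simp add: up_Suc[of 1 "Suc k"] garside_Suc)
qed

lemma garside_square_Suc:
  assumes "Suc k < n"
  shows "garside (Suc k) \<otimes> garside (Suc k)
    = down (Suc k) \<otimes> up 1 (Suc k) \<otimes> (garside k \<otimes> garside k)"
proof -
  have c: "garside k \<in> carrier G" "down (Suc k) \<in> carrier G" "up 1 (Suc k) \<in> carrier G"
    using assms by simp_all
  have "garside (Suc k) \<otimes> garside (Suc k)
      = garside k \<otimes> (down (Suc k) \<otimes> up 1 (Suc k)) \<otimes> garside k"
    using c garside_Suc[OF assms] garside_Suc'[OF assms] by (simp add: m_assoc)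
  also have "\<dots> = down (Suc k) \<otimes> up 1 (Suc k) \<otimes> garside k \<otimes> garside k"
    by (simp only: down_up_garside[OF assms])
  finally show ?thesis using c by (simp add: m_assoc)
qed

lemma down_up:
  assumes "1 \<le> i" "j < k" "k < n"
  shows "down k \<otimes> up (Suc i) (Suc j) = up i j \<otimes> down k"
proof -
  have "up (Suc i) (Suc j) = lprod (map (\<lambda>l. s (Suc l)) [i..<Suc j])"
    unfolding up_def by (simp flip: map_Suc_upt add: comp_def del: upt_Suc)
  also have "down k \<otimes> \<dots> = up i j \<otimes> down k"
    unfolding up_def
    by (rule lprod_intertwine) (use assms down_s in \<open>auto simp: s_closed\<close>)
  finally show ?thesis .
qed

text \<open>Splitting off \<open>s_(k+1)\<close> from each of the factors \<open>down (Suc k) = s_(k+1) down k\<close> and collecting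
  these crossings on the left, where \<open>down_up\<close> has lowered their indices, leaves the power of
  \<open>down k\<close>. For \<open>j = Suc k\<close> the collected crossings are \<open>s_1 \<dots> s_(k+1)\<close>.\<close>

lemma down_pow:
  assumes "Suc k < n" "j \<le> Suc k"
  shows "down (Suc k) [^] j = up (Suc (Suc k) - j) (Suc k) \<otimes> down k [^] j"
  using assms(2)
proof (induction j)
  case (Suc j)
  define i where "i = Suc k - j"
  have i: "1 \<le> i" "i \<le> Suc k" "Suc (Suc k) - j = Suc i" "Suc (Suc k) - Suc j = i"
    using Suc.prems by (auto simp: i_def)
  have c: "down k \<in> carrier G" "down (Suc k) \<in> carrier G" "up (Suc i) (Suc k) \<in> carrier G"
    "up i k \<in> carrier G" "s (Suc k) \<in> carrier G"
    using assms i by (auto simp: s_closed)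
  have "down (Suc k) [^] Suc j = down (Suc k) \<otimes> (up (Suc i) (Suc k) \<otimes> down k [^] j)"
    using Suc i c by (simp only: nat_pow_Suc2)
  also have "\<dots> = up i k \<otimes> down (Suc k) \<otimes> down k [^] j"
    using down_up[of i k "Suc k"] i c assms by (simp flip: m_assoc)
  also have "\<dots> = up i k \<otimes> s (Suc k) \<otimes> (down k \<otimes> down k [^] j)"
    using c by (simp add: down_Suc m_assoc)
  also have "\<dots> = up i (Suc k) \<otimes> down k [^] Suc j"
    using c i assms by (simp only: up_Suc nat_pow_Suc2)
  finally show ?case using i by simp
qed simp

text \<open>Both sides acquire the same factor \<open>down (Suc k) up 1 (Suc k)\<close> when a string is added: the
  power by \<open>down_pow\<close>, the square of the half twist by \<open>garside_square_Suc\<close>.\<close>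

lemma down_pow_full_twist: "k < n \<Longrightarrow> down k [^] Suc k = garside k \<otimes> garside k"
proof (induction k)
  case (Suc k)
  have c: "down k \<in> carrier G" "down (Suc k) \<in> carrier G" "up 1 (Suc k) \<in> carrier G"
    using Suc.prems by simp_all
  have "down (Suc k) [^] Suc (Suc k) = down (Suc k) \<otimes> (up 1 (Suc k) \<otimes> down k [^] Suc k)"
    using down_pow[of k "Suc k"] Suc.prems c nat_pow_Suc2[of "down (Suc k)" "Suc k"] by (simp add: One_nat_def)
  also have "\<dots> = down (Suc k) \<otimes> up 1 (Suc k) \<otimes> down k [^] Suc k"
    using c by (intro m_assoc[symmetric]) auto
  finally show ?case using Suc garside_square_Suc[of k] by simp
qed simp

text \<open>Conjugation by the half twist turns \<open>down m\<close> into \<open>up 1 m\<close>, which the sphere relation makes the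
  inverse of \<open>down m\<close>. The full twist is a power of \<open>down m\<close> and commutes with the half twist, so
  it is its own inverse.\<close>

theorem garside_pow_4:
  assumes "m < n" and sphere: "down m \<otimes> up 1 m = \<one>"
  shows "garside m [^] (4::nat) = \<one>"
proof -
  let ?t = "garside m"
  have c: "?t \<in> carrier G" "down m \<in> carrier G" "up 1 m \<in> carrier G" using assms by simp_all
  have "?t \<otimes> down m = up 1 m \<otimes> ?t"
  proof (cases m)
    case (Suc k)
    then show ?thesis
      using assms c garside_Suc[of k] garside_Suc'[of k] by (metis m_assoc garside_closed Suc_lessD)
  qed simp
  then have "?t \<otimes> (?t \<otimes> ?t) = up 1 m [^] Suc m \<otimes> ?t"
    using pow_intertwine[OF c(2,3,1), of "Suc m"] down_pow_full_twist[OF assms(1)] by metis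
  then have "?t \<otimes> ?t = up 1 m [^] Suc m"
    using c by (metis m_assoc right_cancel m_closed nat_pow_closed)
  moreover have "?t [^] (4::nat) = (?t \<otimes> ?t) \<otimes> (?t \<otimes> ?t)"
    using c by (simp add: numeral_eq_Suc m_assoc)
  ultimately have "?t [^] (4::nat) = down m [^] Suc m \<otimes> up 1 m [^] Suc m"
    using down_pow_full_twist[OF assms(1)] by metis
  also have "\<dots> = (down m \<otimes> up 1 m) [^] Suc m"
    using c sphere by (intro pow_mult_distrib[symmetric]) (metis inv_comm)
  finally show ?thesis using sphere by simp
qed

end

end


section \<open>Twists in a braided category\<close>

context braided_strict_monoidal_category
begin

lemma whisker_comp:
  assumes "p \<in> Obj C" "q \<in> Obj C" "f \<in> Hom C b c" "g \<in> Hom C a b"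
  shows "Idt C p \<boxtimes> (f \<cdot> g) \<boxtimes> Idt C q
    = (Idt C p \<boxtimes> f \<boxtimes> Idt C q) \<cdot> (Idt C p \<boxtimes> g \<boxtimes> Idt C q)"
proof -
  note p = id_hom[OF assms(1)] and q = id_hom[OF assms(2)]
  have "Idt C p \<boxtimes> (f \<cdot> g) = (Idt C p \<boxtimes> f) \<cdot> (Idt C p \<boxtimes> g)"
    using interchange[OF p p assms(3,4)] by (simp add: id_comp[OF p])
  then show ?thesis
    using interchange[OF tens_hom[OF p assms(3)] tens_hom[OF p assms(4)] q q]
    by (simp add: id_comp[OF q])
qed

text \<open>Naturality of the twist of \<open>a \<otimes> a\<close> with \<open>a\<close>, applied to the arrow \<open>Twist C a a\<close> itself.\<close>

lemma yang_baxter: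
  assumes "a \<in> Obj C"
  shows "(Twist C a a \<boxtimes> Idt C a) \<cdot> ((Idt C a \<boxtimes> Twist C a a) \<cdot> (Twist C a a \<boxtimes> Idt C a))
    = (Idt C a \<boxtimes> Twist C a a) \<cdot> ((Twist C a a \<boxtimes> Idt C a) \<cdot> (Idt C a \<boxtimes> Twist C a a))"
proof -
  note i = id_hom[OF assms] and t = twist_hom[OF assms assms]
  have h: "Twist C a a \<boxtimes> Idt C a \<in> Hom C (a \<boxdot> (a \<boxdot> a)) (a \<boxdot> (a \<boxdot> a))"
    "Idt C a \<boxtimes> Twist C a a \<in> Hom C (a \<boxdot> (a \<boxdot> a)) (a \<boxdot> (a \<boxdot> a))"
    using tens_hom[OF t i] tens_hom[OF i t] assms by (simp_all add: otens_assoc)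
  have "Twist C (a \<boxdot> a) a \<cdot> (Twist C a a \<boxtimes> Idt C a)
      = (Idt C a \<boxtimes> Twist C a a) \<cdot> Twist C (a \<boxdot> a) a"
    by (rule twist_natural[OF t i])
  then show ?thesis
    unfolding twist_otens_left[OF assms assms assms] using comp_assoc[OF h(1,2,1)] by simp
qed

text \<open>The hexagon laws with unit objects make both twists idempotent, and an invertible idempotent is
  an identity.\<close>

lemma twist_unit:
  assumes "a \<in> Obj C"
  shows "Twist C a (Unit C) = Idt C a" and "Twist C (Unit C) a = Idt C a"
proof -
  have idem: "t = Idt C a" if t: "t \<in> Hom C a a" "t \<cdot> t = t" "\<exists>g. is_inverse C a a t g" for t
  proof -
    obtain g where "g \<in> Hom C a a" "g \<cdot> t = Idt C a" using t(3) by (auto simp: is_inverse_def)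
    then show ?thesis using comp_assoc[of g a a t a t] t(1,2) id_comp by metis
  qed
  have h: "Twist C a (Unit C) \<in> Hom C a a" "Twist C (Unit C) a \<in> Hom C a a"
    using twist_hom[OF assms unit_obj] twist_hom[OF unit_obj assms] assms
    by (simp_all add: otens_unit unit_otens)
  show "Twist C a (Unit C) = Idt C a"
    using twist_otens_right[OF assms unit_obj unit_obj] twist_iso[OF assms unit_obj] h(1) assms
    by (intro idem) (simp_all add: otens_unit unit_otens unit_obj tens_unit unit_tens)
  show "Twist C (Unit C) a = Idt C a"
    using twist_otens_left[OF unit_obj unit_obj assms] twist_iso[OF unit_obj assms] h(2) assms
    by (intro idem) (simp_all add: otens_unit unit_otens unit_obj tens_unit unit_tens)
qed

end


section \<open>A box absorbs a full turn of one of its strings\<close>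

context tangle_algebra
begin

text \<open>\<open>A\<close> is its own dual: \<open>r\<close> is \<open>R\<close> with its last string bent round by \<open>\<epsilon>\<close>, and bending it back
  with \<open>\<eta>\<close> recovers \<open>R\<close> by a zigzag law.\<close>

lemma factor_through_eta:
  assumes X: "X \<in> Obj C" and R: "R \<in> Hom C (Unit C) (X \<boxdot> A)"
  obtains r where "r \<in> Hom C A X" "(r \<boxtimes> Idt C A) \<cdot> \<eta> = R"
proof
  let ?r = "(Idt C X \<boxtimes> \<epsilon>) \<cdot> (R \<boxtimes> Idt C A)"
  note A = A_obj and iA = id_hom[OF A_obj] and iX = id_hom[OF X] and iI = id_hom[OF unit_obj]
  note XA = otens_obj[OF X A] and AA = otens_obj[OF A A]
  have RA: "R \<boxtimes> Idt C A \<in> Hom C A (X \<boxdot> (A \<boxdot> A))"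
    using tens_hom[OF R iA] X A by (simp add: otens_assoc unit_otens)
  have Xe: "Idt C X \<boxtimes> \<epsilon> \<in> Hom C (X \<boxdot> (A \<boxdot> A)) X"
    using tens_hom[OF iX eps_hom] X A by (simp add: otens_assoc otens_unit)
  show r: "?r \<in> Hom C A X" by (rule comp_hom[OF Xe RA])
  have XeA: "(Idt C X \<boxtimes> \<epsilon>) \<boxtimes> Idt C A \<in> Hom C (X \<boxdot> (A \<boxdot> (A \<boxdot> A))) (X \<boxdot> A)"
    using tens_hom[OF Xe iA] X A by (simp add: otens_assoc otens_obj)
  have RAA: "(R \<boxtimes> Idt C A) \<boxtimes> Idt C A \<in> Hom C (A \<boxdot> A) (X \<boxdot> (A \<boxdot> (A \<boxdot> A)))"
    using tens_hom[OF RA iA] X A by (simp add: otens_assoc otens_obj)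
  have Xeta: "Idt C (X \<boxdot> A) \<boxtimes> \<eta> \<in> Hom C (X \<boxdot> A) (X \<boxdot> (A \<boxdot> (A \<boxdot> A)))"
    using tens_hom[OF id_hom[OF XA] eta_hom] X A by (simp add: otens_assoc otens_obj otens_unit)
  have "((R \<boxtimes> Idt C A) \<boxtimes> Idt C A) \<cdot> \<eta> = (R \<boxtimes> Idt C (A \<boxdot> A)) \<cdot> (Idt C (Unit C) \<boxtimes> \<eta>)"
    by (simp add: tens_assoc[OF R iA iA] tens_id A unit_tens[OF eta_hom])
  also have "\<dots> = R \<boxtimes> \<eta>"
    using interchange[OF R iI id_hom[OF AA] eta_hom] by (simp add: comp_id[OF R] id_comp[OF eta_hom])
  also have "\<dots> = (Idt C (X \<boxdot> A) \<boxtimes> \<eta>) \<cdot> R"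
    using interchange[OF id_hom[OF XA] R eta_hom iI]
    by (simp add: id_comp[OF R] comp_id[OF eta_hom] tens_unit[OF R])
  finally have slide: "((R \<boxtimes> Idt C A) \<boxtimes> Idt C A) \<cdot> \<eta> = (Idt C (X \<boxdot> A) \<boxtimes> \<eta>) \<cdot> R" .
  \<comment> \<open>After \<open>\<eta>\<close> has been slid to the outside of \<open>R\<close>, it meets \<open>\<epsilon>\<close> in a zigzag.\<close>
  have eA: "\<epsilon> \<boxtimes> Idt C A \<in> Hom C (A \<boxdot> (A \<boxdot> A)) A" "Idt C A \<boxtimes> \<eta> \<in> Hom C A (A \<boxdot> (A \<boxdot> A))"
    using tens_hom[OF eps_hom iA] tens_hom[OF iA eta_hom] A
    by (simp_all add: otens_assoc unit_otens otens_unit)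
  have "((Idt C X \<boxtimes> \<epsilon>) \<boxtimes> Idt C A) \<cdot> (Idt C (X \<boxdot> A) \<boxtimes> \<eta>)
      = (Idt C X \<boxtimes> (\<epsilon> \<boxtimes> Idt C A)) \<cdot> (Idt C X \<boxtimes> (Idt C A \<boxtimes> \<eta>))"
    by (simp add: tens_assoc[OF iX eps_hom iA] tens_id[OF X A, symmetric] tens_assoc[OF iX iA eta_hom])
  also have "\<dots> = Idt C (X \<boxdot> A)"
    using interchange[OF iX iX eA] by (simp add: id_comp[OF iX] zigzag_left tens_id X A)
  finally have zigzag: "((Idt C X \<boxtimes> \<epsilon>) \<boxtimes> Idt C A) \<cdot> (Idt C (X \<boxdot> A) \<boxtimes> \<eta>) = Idt C (X \<boxdot> A)" .
  have "?r \<boxtimes> Idt C A = ((Idt C X \<boxtimes> \<epsilon>) \<boxtimes> Idt C A) \<cdot> ((R \<boxtimes> Idt C A) \<boxtimes> Idt C A)"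
    using interchange[OF Xe RA iA iA] by (simp add: id_comp[OF iA])
  then have "(?r \<boxtimes> Idt C A) \<cdot> \<eta> = ((Idt C X \<boxtimes> \<epsilon>) \<boxtimes> Idt C A) \<cdot> ((Idt C (X \<boxdot> A) \<boxtimes> \<eta>) \<cdot> R)"
    by (simp add: comp_assoc[OF XeA RAA eta_hom] slide)
  also have "\<dots> = R"
    by (simp add: comp_assoc[OF XeA Xeta R, symmetric] zigzag id_comp[OF R])
  finally show "(?r \<boxtimes> Idt C A) \<cdot> \<eta> = R" .
qed

text \<open>Each of the two twists slides past \<open>r\<close> to become a self-crossing of the bent string, which \<open>\<eta>\<close>
  swallows.\<close>

lemma monodromy_absorbed:
  assumes X: "X \<in> Obj C" and R: "R \<in> Hom C (Unit C) (X \<boxdot> A)"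
  shows "Twist C A X \<cdot> (Twist C X A \<cdot> R) = R"
proof -
  obtain r where r: "r \<in> Hom C A X" "(r \<boxtimes> Idt C A) \<cdot> \<eta> = R"
    using factor_through_eta[OF assms] .
  note iA = id_hom[OF A_obj] and tw = twist_hom[OF A_obj A_obj]
  note h = tens_hom[OF r(1) iA] tens_hom[OF iA r(1)] twist_hom[OF X A_obj] twist_hom[OF A_obj X]
  have "Twist C X A \<cdot> R = (Idt C A \<boxtimes> r) \<cdot> \<eta>"
    using comp_assoc[OF h(3,1) eta_hom] comp_assoc[OF h(2) tw eta_hom]
    by (simp add: twist_natural[OF r(1) iA] twist_eta flip: r(2))
  moreover have "Twist C A X \<cdot> ((Idt C A \<boxtimes> r) \<cdot> \<eta>) = R"
    using comp_assoc[OF h(4,2) eta_hom] comp_assoc[OF h(1) tw eta_hom]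
    by (simp add: twist_natural[OF iA r(1)] twist_eta r(2))
  ultimately show ?thesis by simp
qed

end


section \<open>The braids \<open>\<sigma>_i\<close> in the free category\<close>

lemma Tangle_hom_simps:
  "tcls n (TId a) \<in> Hom (Tangle n) a a"
  "tcls n (TTwist a b) \<in> Hom (Tangle n) (a + b) (b + a)"
  by (simp_all add: Tangle_HomI ty_id ty_twist)

lemma sigma_Tangle:
  "sigma (Tangle n) gen_A n i
    = tcls n (TId (i - 1)) \<boxtimes>\<^bsub>Tangle n\<^esub> tcls n (TTwist 1 1) \<boxtimes>\<^bsub>Tangle n\<^esub> tcls n (TId (n - i - 1))"
  by (simp add: sigma_def del: opow.simps)

lemma sigma_hom:
  assumes "1 \<le> i" "i < n"
  shows "sigma (Tangle n) gen_A n i \<in> Hom (Tangle n) n n"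
  using assms by (intro Tbraids_hom sigma_Tbraids)

text \<open>Cutting the strings between the two crossings displays the braids as \<open>f \<otimes> 1\<close> and \<open>1 \<otimes> g\<close>,
  which commute by the interchange law.\<close>

lemma sigma_far_commute:
  assumes "1 \<le> i" "Suc i < j" "j < n"
  shows "sigma (Tangle n) gen_A n i \<cdot>\<^bsub>Tangle n\<^esub> sigma (Tangle n) gen_A n j
    = sigma (Tangle n) gen_A n j \<cdot>\<^bsub>Tangle n\<^esub> sigma (Tangle n) gen_A n i"
proof -
  define f where "f = tcls n (TId (i - 1)) \<boxtimes>\<^bsub>Tangle n\<^esub> tcls n (TTwist 1 1)"
  define g where "g = tcls n (TId (j - i - 2)) \<boxtimes>\<^bsub>Tangle n\<^esub> tcls n (TTwist 1 1) \<boxtimes>\<^bsub>Tangle n\<^esub>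
    tcls n (TId (n - j - 1))"
  let ?a = "i + 1" and ?b = "n - i - 1"
  have f: "f \<in> Hom (Tangle n) ?a ?a"
    using Tangle.tens_hom[OF Tangle_hom_simps(1)[of n "i - 1"] Tangle_hom_simps(2)[of n 1 1]] assms
    by (simp add: f_def)
  have g0: "tcls n (TId (j - i - 2)) \<boxtimes>\<^bsub>Tangle n\<^esub> tcls n (TTwist 1 1) \<in> Hom (Tangle n) (j - i) (j - i)"
    using Tangle.tens_hom[OF Tangle_hom_simps(1)[of n "j - i - 2"] Tangle_hom_simps(2)[of n 1 1]] assms
    by (simp add: numeral_2_eq_2 Suc_diff_Suc)
  have "j - i + (n - j - 1) = ?b" using assms by simp
  then have g: "g \<in> Hom (Tangle n) ?b ?b"
    using Tangle.tens_hom[OF g0 Tangle_hom_simps(1)[of n "n - j - 1"]] by (simp add: g_def)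
  have i: "sigma (Tangle n) gen_A n i = f \<boxtimes>\<^bsub>Tangle n\<^esub> tcls n (TId ?b)"
    by (simp add: sigma_Tangle[unfolded One_nat_def] f_def)
  have "j - 1 = ?a + (j - i - 2)" using assms by simp
  then have "tcls n (TId (j - 1)) = tcls n (TId ?a) \<boxtimes>\<^bsub>Tangle n\<^esub> tcls n (TId (j - i - 2))"
    using Tangle.tens_id[of ?a n "j - i - 2"] by (simp only: Tangle_simps UNIV_I)
  then have j: "sigma (Tangle n) gen_A n j = tcls n (TId ?a) \<boxtimes>\<^bsub>Tangle n\<^esub> g"
    using Tangle.tens_assoc[OF Tangle_hom_simps(1)[of n ?a] Tangle_hom_simps(1)[of n "j - i - 2"]
        Tangle_hom_simps(2)[of n 1 1]]
      Tangle.tens_assoc[OF Tangle_hom_simps(1)[of n ?a] g0 Tangle_hom_simps(1)[of n "n - j - 1"]]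
    by (simp add: sigma_Tangle[unfolded One_nat_def] g_def)
  note i1 = Tangle_hom_simps(1)[of n ?a] and i2 = Tangle_hom_simps(1)[of n ?b]
  show ?thesis
    unfolding i j
    using Tangle.interchange[OF f i1 i2 g] Tangle.interchange[OF i1 f g i2]
      Tangle.comp_id[OF f] Tangle.id_comp[OF f] Tangle.comp_id[OF g] Tangle.id_comp[OF g]
    by simp
qed

lemma sigma_braid_relation:
  assumes "1 \<le> i" "Suc i < n"
  shows "sigma (Tangle n) gen_A n i \<cdot>\<^bsub>Tangle n\<^esub>
      (sigma (Tangle n) gen_A n (Suc i) \<cdot>\<^bsub>Tangle n\<^esub> sigma (Tangle n) gen_A n i)
    = sigma (Tangle n) gen_A n (Suc i) \<cdot>\<^bsub>Tangle n\<^esub>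
      (sigma (Tangle n) gen_A n i \<cdot>\<^bsub>Tangle n\<^esub> sigma (Tangle n) gen_A n (Suc i))"
proof -
  let ?t = "tcls n (TTwist 1 1)" and ?p = "tcls n (TId (i - 1))" and ?q = "tcls n (TId (n - i - 2))"
    and ?I = "tcls n (TId 1)"
  let ?L = "?t \<boxtimes>\<^bsub>Tangle n\<^esub> ?I" and ?R = "?I \<boxtimes>\<^bsub>Tangle n\<^esub> ?t"
  note tw = Tangle_hom_simps(2)[of n 1 1] and id = Tangle_hom_simps(1)[of n]
  have L: "?L \<in> Hom (Tangle n) 3 3" and R: "?R \<in> Hom (Tangle n) 3 3"
    using Tangle.tens_hom[OF tw id[of 1]] Tangle.tens_hom[OF id[of 1] tw]
    by (simp_all add: eval_nat_numeral)
  have "tcls n (TId (n - i - 1)) = ?I \<boxtimes>\<^bsub>Tangle n\<^esub> ?q"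
    using Tangle.tens_id[of 1 n "n - i - 2"] assms by (simp add: numeral_2_eq_2 Suc_diff_Suc)
  then have i: "sigma (Tangle n) gen_A n i = ?p \<boxtimes>\<^bsub>Tangle n\<^esub> ?L \<boxtimes>\<^bsub>Tangle n\<^esub> ?q"
    using Tangle.tens_assoc[OF Tangle.tens_hom[OF id tw] id id, of "i - 1" 1 "n - i - 2"]
      Tangle.tens_assoc[OF id tw id, of "i - 1" 1]
    by (simp add: sigma_Tangle[unfolded One_nat_def])
  have "tcls n (TId i) = ?p \<boxtimes>\<^bsub>Tangle n\<^esub> ?I"
    using Tangle.tens_id[of "i - 1" n 1] assms by simp
  then have j: "sigma (Tangle n) gen_A n (Suc i) = ?p \<boxtimes>\<^bsub>Tangle n\<^esub> ?R \<boxtimes>\<^bsub>Tangle n\<^esub> ?q"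
    using Tangle.tens_assoc[OF id id tw, of "i - 1" 1]
    by (simp add: sigma_Tangle[unfolded One_nat_def] numeral_2_eq_2)
  have w: "?p \<boxtimes>\<^bsub>Tangle n\<^esub> (f \<cdot>\<^bsub>Tangle n\<^esub> g) \<boxtimes>\<^bsub>Tangle n\<^esub> ?q
      = (?p \<boxtimes>\<^bsub>Tangle n\<^esub> f \<boxtimes>\<^bsub>Tangle n\<^esub> ?q) \<cdot>\<^bsub>Tangle n\<^esub> (?p \<boxtimes>\<^bsub>Tangle n\<^esub> g \<boxtimes>\<^bsub>Tangle n\<^esub> ?q)"
    if "f \<in> Hom (Tangle n) 3 3" "g \<in> Hom (Tangle n) 3 3" for f g
    using Tangle.whisker_comp[OF _ _ that, of "i - 1" "n - i - 2"] by simp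
  have "?L \<cdot>\<^bsub>Tangle n\<^esub> (?R \<cdot>\<^bsub>Tangle n\<^esub> ?L) = ?R \<cdot>\<^bsub>Tangle n\<^esub> (?L \<cdot>\<^bsub>Tangle n\<^esub> ?R)"
    using Tangle.yang_baxter[of 1 n] by simp
  then show ?thesis
    unfolding i j using L R by (simp only: w[symmetric] Tangle_comp_hom)
qed

lemma comp_list_simps:
  "comp_list C a [] = Idt C a" "comp_list C a (f # fs) = f \<cdot>\<^bsub>C\<^esub> comp_list C a fs"
  by (simp_all add: comp_list_def)

lemma (in braided_strict_monoidal_category) comp_list_hom:
  "\<lbrakk>a \<in> Obj C; set fs \<subseteq> Hom C a a\<rbrakk> \<Longrightarrow> comp_list C a fs \<in> Hom C a a"
  by (induction fs) (auto simp: comp_list_simps id_hom intro: comp_hom)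

lemma (in braided_strict_monoidal_category) comp_list_append_single:
  assumes "f \<in> Hom C a a" "set fs \<subseteq> Hom C a a"
  shows "comp_list C a (fs @ [f]) = comp_list C a fs \<cdot> f"
  using assms(2)
proof (induction fs)
  case Nil
  show ?case using assms(1) id_comp comp_id by (simp add: comp_list_simps)
next
  case (Cons g fs)
  have "comp_list C a fs \<in> Hom C a a"
    using Cons.prems assms(1) hom_obj by (intro comp_list_hom) auto
  then show ?case using Cons assms(1) comp_assoc[of g a a "comp_list C a fs" a f a]
    by (simp add: comp_list_simps)
qed

text \<open>By the hexagon law, a string crosses \<open>k\<close> others one at a time.\<close>

lemma comp_list_sigma_down:
  "k < n \<Longrightarrow> comp_list (Tangle n) n (map (sigma (Tangle n) gen_A n) (rev [1..<Suc k]))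
    = tcls n (TTwist 1 k) \<boxtimes>\<^bsub>Tangle n\<^esub> tcls n (TId (n - k - 1))"
proof (induction k)
  case 0
  then show ?case
    using Tangle.twist_unit(1)[of 1 n] Tangle.tens_id[of 1 n "n - 1"] by (simp add: comp_list_simps)
next
  case (Suc k)
  note id = Tangle_hom_simps(1)[of n] and tw = Tangle_hom_simps(2)[of n]
  let ?q = "n - k - 2"
  have q: "n - k - 1 = 1 + ?q" "n - Suc k - 1 = ?q" using Suc.prems by auto
  have s: "sigma (Tangle n) gen_A n (Suc k)
      = tcls n (TId k) \<boxtimes>\<^bsub>Tangle n\<^esub> tcls n (TTwist 1 1) \<boxtimes>\<^bsub>Tangle n\<^esub> tcls n (TId ?q)"
    by (simp add: sigma_Tangle[unfolded One_nat_def])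
  have d: "tcls n (TTwist 1 k) \<boxtimes>\<^bsub>Tangle n\<^esub> tcls n (TId (n - k - 1))
      = tcls n (TTwist 1 k) \<boxtimes>\<^bsub>Tangle n\<^esub> tcls n (TId 1) \<boxtimes>\<^bsub>Tangle n\<^esub> tcls n (TId ?q)"
    unfolding q(1) using Tangle.tens_assoc[OF tw id id, of 1 k 1 ?q] Tangle.tens_id[of 1 n ?q] by simp
  have "tcls n (TTwist 1 (Suc k)) = tcls n (TId k) \<boxtimes>\<^bsub>Tangle n\<^esub> tcls n (TTwist 1 1) \<cdot>\<^bsub>Tangle n\<^esub>
      (tcls n (TTwist 1 k) \<boxtimes>\<^bsub>Tangle n\<^esub> tcls n (TId 1))"
    using Tangle.twist_otens_right[of 1 n k 1] by simp
  moreover have h: "tcls n (TId k) \<boxtimes>\<^bsub>Tangle n\<^esub> tcls n (TTwist 1 1) \<in> Hom (Tangle n) (k + 2) (k + 2)"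
    "tcls n (TTwist 1 k) \<boxtimes>\<^bsub>Tangle n\<^esub> tcls n (TId 1) \<in> Hom (Tangle n) (k + 2) (k + 2)"
    using Tangle.tens_hom[OF id[of k] tw[of 1 1]] Tangle.tens_hom[OF tw[of 1 k] id[of 1]] by simp_all
  ultimately have "tcls n (TTwist 1 (Suc k)) \<boxtimes>\<^bsub>Tangle n\<^esub> tcls n (TId ?q)
      = sigma (Tangle n) gen_A n (Suc k) \<cdot>\<^bsub>Tangle n\<^esub>
        (tcls n (TTwist 1 k) \<boxtimes>\<^bsub>Tangle n\<^esub> tcls n (TId (n - k - 1)))"
    unfolding s d
    using Tangle.interchange[OF h id[of ?q] id[of ?q]] Tangle.id_comp[OF id[of ?q]] by simp
  moreover have "comp_list (Tangle n) n (map (sigma (Tangle n) gen_A n) (rev [1..<Suc (Suc k)]))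
      = sigma (Tangle n) gen_A n (Suc k) \<cdot>\<^bsub>Tangle n\<^esub>
        comp_list (Tangle n) n (map (sigma (Tangle n) gen_A n) (rev [1..<Suc k]))"
    by (simp add: comp_list_simps)
  ultimately show ?case unfolding q(2) Suc.IH[OF Suc_lessD[OF Suc.prems]] by (simp only:)
qed

lemma comp_list_sigma_up:
  "k < n \<Longrightarrow> comp_list (Tangle n) n (map (sigma (Tangle n) gen_A n) [1..<Suc k])
    = tcls n (TTwist k 1) \<boxtimes>\<^bsub>Tangle n\<^esub> tcls n (TId (n - k - 1))"
proof (induction k)
  case 0
  then show ?case
    using Tangle.twist_unit(2)[of 1 n] Tangle.tens_id[of 1 n "n - 1"] by (simp add: comp_list_simps)
next
  case (Suc k)
  note id = Tangle_hom_simps(1)[of n] and tw = Tangle_hom_simps(2)[of n]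
  let ?q = "n - k - 2" and ?s = "sigma (Tangle n) gen_A n"
  have q: "n - k - 1 = 1 + ?q" "n - Suc k - 1 = ?q" using Suc.prems by auto
  have s: "?s (Suc k)
      = tcls n (TId k) \<boxtimes>\<^bsub>Tangle n\<^esub> tcls n (TTwist 1 1) \<boxtimes>\<^bsub>Tangle n\<^esub> tcls n (TId ?q)"
    by (simp add: sigma_Tangle[unfolded One_nat_def])
  have d: "tcls n (TTwist k 1) \<boxtimes>\<^bsub>Tangle n\<^esub> tcls n (TId (n - k - 1))
      = tcls n (TTwist k 1) \<boxtimes>\<^bsub>Tangle n\<^esub> tcls n (TId 1) \<boxtimes>\<^bsub>Tangle n\<^esub> tcls n (TId ?q)"
    unfolding q(1) using Tangle.tens_assoc[OF tw id id, of k 1 1 ?q] Tangle.tens_id[of 1 n ?q] by simp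
  have "tcls n (TTwist (Suc k) 1) = tcls n (TTwist k 1) \<boxtimes>\<^bsub>Tangle n\<^esub> tcls n (TId 1) \<cdot>\<^bsub>Tangle n\<^esub>
      (tcls n (TId k) \<boxtimes>\<^bsub>Tangle n\<^esub> tcls n (TTwist 1 1))"
    using Tangle.twist_otens_left[of k n 1 1] by simp
  moreover have h: "tcls n (TId k) \<boxtimes>\<^bsub>Tangle n\<^esub> tcls n (TTwist 1 1) \<in> Hom (Tangle n) (k + 2) (k + 2)"
    "tcls n (TTwist k 1) \<boxtimes>\<^bsub>Tangle n\<^esub> tcls n (TId 1) \<in> Hom (Tangle n) (k + 2) (k + 2)"
    using Tangle.tens_hom[OF id[of k] tw[of 1 1]] Tangle.tens_hom[OF tw[of k 1] id[of 1]] by simp_all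
  ultimately have "tcls n (TTwist (Suc k) 1) \<boxtimes>\<^bsub>Tangle n\<^esub> tcls n (TId ?q)
      = (tcls n (TTwist k 1) \<boxtimes>\<^bsub>Tangle n\<^esub> tcls n (TId (n - k - 1))) \<cdot>\<^bsub>Tangle n\<^esub> ?s (Suc k)"
    unfolding s d
    using Tangle.interchange[OF h(2,1) id[of ?q] id[of ?q]] Tangle.id_comp[OF id[of ?q]] by simp
  moreover have "comp_list (Tangle n) n (map ?s [1..<Suc (Suc k)])
      = comp_list (Tangle n) n (map ?s [1..<Suc k]) \<cdot>\<^bsub>Tangle n\<^esub> ?s (Suc k)"
    using Tangle.comp_list_append_single[of "?s (Suc k)" n n "map ?s [1..<Suc k]"] Suc.prems sigma_hom
    by (auto simp: image_subset_iff)
  ultimately show ?case unfolding q(2) Suc.IH[OF Suc_lessD[OF Suc.prems]] by (simp only:)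
qed

lemma full_turn_absorbed_by_R:
  assumes "1 \<le> n"
  shows "tcls n (TTwist 1 (n - 1)) \<cdot>\<^bsub>Tangle n\<^esub> (tcls n (TTwist (n - 1) 1) \<cdot>\<^bsub>Tangle n\<^esub> gen_R n) = gen_R n"
proof -
  interpret M: tangle_model "Tangle n" gen_A "gen_eta n" "gen_eps n" n "gen_R n" "gen_S n"
    by (rule Tangle_tangle_model[OF Tangle_gens(3,4)])
  show ?thesis using M.monodromy_absorbed[of "n - 1" "gen_R n"] Tangle_gens(3)[of n] assms by simp
qed


section \<open>The sphere relation and the fourth power of the half twist\<close>

lemma BB_braid_generators: "braid_generators (BB n) n (\<lambda>i. blocked n (sigma (Tangle n) gen_A n i))"
proof -
  interpret group "BB n" by (rule BB_group)
  let ?s = "sigma (Tangle n) gen_A n"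
  note [simp del] = One_nat_def
  show ?thesis
  proof
    show "blocked n (?s i) \<in> carrier (BB n)" if "1 \<le> i" "i < n" for i
      unfolding BB_carrier using sigma_Tbraids that by blast
    show "blocked n (?s i) \<otimes>\<^bsub>BB n\<^esub> blocked n (?s j) = blocked n (?s j) \<otimes>\<^bsub>BB n\<^esub> blocked n (?s i)"
      if "1 \<le> i" "Suc i < j" "j < n" for i j
      using that sigma_far_commute[OF that] by (simp add: BB_mult sigma_Tbraids)
    show "blocked n (?s i) \<otimes>\<^bsub>BB n\<^esub> (blocked n (?s (Suc i)) \<otimes>\<^bsub>BB n\<^esub> blocked n (?s i))
        = blocked n (?s (Suc i)) \<otimes>\<^bsub>BB n\<^esub> (blocked n (?s i) \<otimes>\<^bsub>BB n\<^esub> blocked n (?s (Suc i)))"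
      if "1 \<le> i" "Suc i < n" for i
      using that sigma_braid_relation[OF that] by (simp add: BB_mult sigma_Tbraids Tbraids_comp)
  qed
qed

lemma blocked_comp_list:
  assumes "set Bs \<subseteq> Tbraids n"
  shows "blocked n (comp_list (Tangle n) n Bs) = monoid.lprod (BB n) (map (blocked n) Bs)"
  using assms
proof (induction Bs)
  case Nil
  interpret group "BB n" by (rule BB_group)
  show ?case by (simp add: comp_list_simps BB_one)
next
  case (Cons B Bs)
  interpret group "BB n" by (rule BB_group)
  show ?case using Cons Tbraids_comp_list[of Bs n] by (simp add: comp_list_simps flip: BB_mult)
qed

interpretation BB: braid_generators "BB n" n "\<lambda>i. blocked n (sigma (Tangle n) gen_A n i)"
  by (rule BB_braid_generators)

lemma sigma_list_Tbraids:
  "\<lbrakk>1 \<le> i; k < n\<rbrakk> \<Longrightarrow> set (map (sigma (Tangle n) gen_A n) [i..<Suc k]) \<subseteq> Tbraids n"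
  "k < n \<Longrightarrow> set (map (sigma (Tangle n) gen_A n) (rev [1..<Suc k])) \<subseteq> Tbraids n"
  using sigma_Tbraids by auto

lemma BB_down:
  "k < n \<Longrightarrow> BB.down n k
    = blocked n (comp_list (Tangle n) n (map (sigma (Tangle n) gen_A n) (rev [1..<Suc k])))"
  unfolding BB.down_def using blocked_comp_list[OF sigma_list_Tbraids(2)]
  by (simp add: comp_def del: upt_Suc)

lemma BB_up:
  "\<lbrakk>1 \<le> i; k < n\<rbrakk> \<Longrightarrow> BB.up n i k
    = blocked n (comp_list (Tangle n) n (map (sigma (Tangle n) gen_A n) [i..<Suc k]))"
  unfolding BB.up_def using blocked_comp_list[OF sigma_list_Tbraids(1)]
  by (simp add: comp_def del: upt_Suc)

lemma BB_garside:
  assumes "1 \<le> n"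
  shows "BB.garside n (n - 1) = blocked n (half_twist (Tangle n) gen_A n)"
proof -
  define D where "D k = comp_list (Tangle n) n (map (sigma (Tangle n) gen_A n) (rev [1..<Suc k]))" for k
  have D: "set (map D [1..<n]) \<subseteq> Tbraids n"
    unfolding D_def using Tbraids_comp_list[OF sigma_list_Tbraids(2)] by (auto simp del: upt_Suc)
  have "half_twist (Tangle n) gen_A n = comp_list (Tangle n) n (map D [1..<n])"
    unfolding half_twist_def opow_Tangle D_def ..
  then have "blocked n (half_twist (Tangle n) gen_A n) = BB.lprod n (map (blocked n \<circ> D) [1..<n])"
    using blocked_comp_list[OF D] by simp
  also have "map (blocked n \<circ> D) [1..<n] = map (BB.down n) [1..<n]"
    by (intro map_cong) (simp_all only: BB_down D_def o_apply set_upt atLeastLessThan_iff)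
  finally show ?thesis unfolding BB.garside_def using assms by (simp del: upt_Suc)
qed

text \<open>The left factor is the twist of \<open>A\<close> with \<open>A^(n-1)\<close>, the right factor the twist back; their
  composite is absorbed by \<open>R\<close>. For \<open>n = 1\<close> both are twists with the unit.\<close>

lemma BB_sphere_relation:
  assumes "1 \<le> n"
  shows "BB.down n (n - 1) \<otimes>\<^bsub>BB n\<^esub> BB.up n 1 (n - 1) = \<one>\<^bsub>BB n\<^esub>"
proof -
  let ?m = "n - 1" and ?s = "sigma (Tangle n) gen_A n"
  let ?D = "tcls n (TTwist 1 ?m)" and ?U = "tcls n (TTwist ?m 1)"
  have D: "comp_list (Tangle n) n (map ?s (rev [1..<Suc ?m])) = ?D"
    and U: "comp_list (Tangle n) n (map ?s [1..<Suc ?m]) = ?U"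
    using comp_list_sigma_down[of ?m n] comp_list_sigma_up[of ?m n] assms
      Tangle.tens_unit[OF Tangle_hom_simps(2)[of n 1 ?m]]
      Tangle.tens_unit[OF Tangle_hom_simps(2)[of n ?m 1]] by (simp_all del: upt_Suc)
  have m: "?m < n" using assms by simp
  have braids: "?D \<in> Tbraids n" "?U \<in> Tbraids n"
    using Tbraids_comp_list[OF sigma_list_Tbraids(2)[OF m]]
      Tbraids_comp_list[OF sigma_list_Tbraids(1)[OF order_refl m]]
    unfolding D U .
  have "?D \<cdot>\<^bsub>Tangle n\<^esub> ?U \<cdot>\<^bsub>Tangle n\<^esub> gen_R n = gen_R n"
    using Tangle.comp_assoc[OF braids[THEN Tbraids_hom] Tangle_gens(3)]
      full_turn_absorbed_by_R[OF assms] by simp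
  then have "blocked n (?D \<cdot>\<^bsub>Tangle n\<^esub> ?U) = \<one>\<^bsub>BB n\<^esub>"
    unfolding BB_one blocked_def
    using Tangle.comp_assoc[OF Tangle_gens(4) Tbraids_hom[OF Tbraids_comp[OF braids]] Tangle_gens(3)]
      Tangle.comp_id[OF Tangle_gens(4)] by simp
  then show ?thesis
    using BB_mult[OF braids] BB_down[OF m] BB_up[OF order_refl m] unfolding D U by simp
qed

theorem theorem6p1:
  fixes n :: nat
  assumes "n \<ge> 1"
  shows "blocked n (half_twist (Tangle n) gen_A n) [^]\<^bsub>BB n\<^esub> (4::nat)
       = blocked n (Idt (Tangle n) (opow (Tangle n) gen_A n))"
proof -
  have "BB.garside n (n - 1) [^]\<^bsub>BB n\<^esub> (4::nat) = \<one>\<^bsub>BB n\<^esub>"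
    using BB.garside_pow_4[OF _ BB_sphere_relation[OF assms]] assms by simp
  then show ?thesis
    unfolding BB_garside[OF assms] BB_one opow_Tangle Tangle_simps .
qed

end
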